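(* Every graph $G$ satisfies \[\chi_{\mathrm{cen}}(G)\leq c\cdot(\mathrm{tw}(G)+1)\cdot\left(\chi_{\mathrm{lin}}(G)+\frac{1}{\log 3}\right),\] where $c=\alpha\log 3<3.7$ and $\alpha=\log 3/\log\left(\frac{1+\sqrt5}{2}\right)$.
   Context: All graphs are finite and simple; logarithms are binary. $\mathrm{tw}(G)$ is the treewidth of $G$. A centered coloring of $G$ assigns integers (colors) to vertices so that every connected subgraph contains a vertex whose color is unique in that subgraph; $\chi_{\mathrm{cen}}(G)$ is the minimum number of colors of such a coloring. A linear coloring requires the same only for every path of $G$ (as a subgraph); $\chi_{\mathrm{lin}}(G)$ is the minimum number of colors of a linear coloring. *)

theory Defs
  imports Complex_Main "Graph_Theory.Graph_Theory"
begin

text \<open>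
  Finite simple graphs are the pair graphs of the Graph Theory entry: finite, loop-free
  digraphs with symmetric arc relation, an edge \<open>uv\<close> being the two arcs \<open>(u, v)\<close> and \<open>(v, u)\<close>.
  The name \<open>connected\<close> is always qualified, since it also denotes topological connectedness;
  the graph-theoretic notion requires a nonempty vertex set.
\<close>

text \<open>
  The library's \<open>tree\<close> excludes directed cycles, and a symmetric digraph with an edge \<open>uv\<close> has
  the directed cycle \<open>u, v, u\<close>. Undirected trees therefore need their own definition.
\<close>

definition undirected_cycle :: "'a pair_pre_digraph \<Rightarrow> 'a list \<Rightarrow> bool" where
  "undirected_cycle G p \<longleftrightarrow>
     vpath p (with_proj G) \<and> 3 \<le> length p \<and> (last p, hd p) \<in> parcs G"

definition undirected_tree :: "'a pair_pre_digraph \<Rightarrow> bool" where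
  "undirected_tree T \<longleftrightarrow>
     pair_graph T \<and> Digraph_Component.connected (with_proj T) \<and> (\<nexists>p. undirected_cycle T p)"

text \<open>
  Every finite tree is isomorphic to one whose nodes are natural numbers, so this node type is
  no restriction.
\<close>

definition tree_decomposition ::
    "'a pair_pre_digraph \<Rightarrow> nat pair_pre_digraph \<Rightarrow> (nat \<Rightarrow> 'a set) \<Rightarrow> bool" where
  "tree_decomposition G T B \<longleftrightarrow>
     undirected_tree T \<and>
     (\<Union>t \<in> pverts T. B t) = pverts G \<and>
     (\<forall>(u, v) \<in> parcs G. \<exists>t \<in> pverts T. u \<in> B t \<and> v \<in> B t) \<and>
     (\<forall>v \<in> pverts G.
        Digraph_Component.connected (with_proj T \<restriction> {t \<in> pverts T. v \<in> B t}))"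

text \<open>Widths are integers, so that the graph without vertices has treewidth \<open>-1\<close>.\<close>

definition decomposition_width :: "nat pair_pre_digraph \<Rightarrow> (nat \<Rightarrow> 'a set) \<Rightarrow> int" where
  "decomposition_width T B = int (Max ((\<lambda>t. card (B t)) ` pverts T)) - 1"

definition treewidth :: "'a pair_pre_digraph \<Rightarrow> int" where
  "treewidth G = (LEAST w. \<exists>T B. tree_decomposition G T B \<and> decomposition_width T B = w)"

definition has_unique_color :: "('a \<Rightarrow> int) \<Rightarrow> 'a set \<Rightarrow> bool" where
  "has_unique_color c S \<longleftrightarrow> (\<exists>v \<in> S. \<forall>w \<in> S. c w = c v \<longrightarrow> w = v)"

definition centered_coloring :: "'a pair_pre_digraph \<Rightarrow> ('a \<Rightarrow> int) \<Rightarrow> bool" where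
  "centered_coloring G c \<longleftrightarrow>
     (\<forall>H. pair_graph H \<and> subgraph (with_proj H) (with_proj G) \<and>
          Digraph_Component.connected (with_proj H) \<longrightarrow> has_unique_color c (pverts H))"

definition linear_coloring :: "'a pair_pre_digraph \<Rightarrow> ('a \<Rightarrow> int) \<Rightarrow> bool" where
  "linear_coloring G c \<longleftrightarrow> (\<forall>p. vpath p (with_proj G) \<longrightarrow> has_unique_color c (set p))"

definition chi_cen :: "'a pair_pre_digraph \<Rightarrow> nat" where
  "chi_cen G = (LEAST k. \<exists>c. centered_coloring G c \<and> card (c ` pverts G) = k)"

definition chi_lin :: "'a pair_pre_digraph \<Rightarrow> nat" where
  "chi_lin G = (LEAST k. \<exists>c. linear_coloring G c \<and> card (c ` pverts G) = k)"

end

theory Submission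
  imports Defs "HOL-Library.Tree" "HOL-Number_Theory.Fib"
begin

text \<open>
  Write \<open>K\<close> for the treewidth plus one and \<open>k\<close> for the linear chromatic number.

  If a connected set needs more than \<open>n + K\<close> colors, it contains two disjoint connected sets that
  each need more than \<open>n\<close>: otherwise the sets needing more than \<open>n\<close> colors meet pairwise, so by the
  Helly property of subtrees one bag of the tree decomposition meets them all, and giving the at
  most \<open>K\<close> vertices of this bag private colors leaves a set that \<open>n\<close> colors suffice for. Iterating
  this, a graph that needs more than \<open>m K\<close> colors contains a binary tree with at least
  \<open>fib (m + 2)\<close> vertices: split into two connected parts, recurse with full strength in the part
  away from the root, and hang trees of the previous rank along the path that leads there.

  A binary tree with a linear coloring in \<open>k\<close> colors has at most \<open>4 ^ k\<close> vertices. Record for each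
  vertex which colors occur an odd number of times on the path from the root. Two vertices with the
  same record are joined by a path on which every color but that of the topmost vertex occurs
  evenly, so this color is the unique one and is absent below. Hence the topmost vertices of such
  paths on one branch have distinct colors, each of the \<open>2 ^ k\<close> classes has at most \<open>2 ^ k\<close> members,
  and \<open>\<phi> ^ m \<le> fib (m + 2) \<le> 4 ^ k\<close> with the golden ratio \<open>\<phi>\<close>. This gives
  \<open>chi_cen \<le> K (2 k / log \<phi> + 1)\<close>, and \<open>2 < (log 3)\<^sup>2\<close>, \<open>log \<phi> < log 3\<close>.
\<close>

subsection \<open>Connected vertex sets and centered colorings\<close>

abbreviation walk_in :: "('a \<times> 'a) set \<Rightarrow> 'a list \<Rightarrow> bool" where
  "walk_in E \<equiv> successively (\<lambda>x y. (x, y) \<in> E)"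

text \<open>Connectedness is expressed by cuts, which avoids reachability in induced subgraphs.\<close>

definition linked :: "('a \<times> 'a) set \<Rightarrow> 'a set \<Rightarrow> bool" where
  "linked E W \<longleftrightarrow> W \<noteq> {} \<and> (\<forall>A. A \<noteq> {} \<and> A \<subset> W \<longrightarrow> (\<exists>a\<in>A. \<exists>b\<in>W - A. (a, b) \<in> E))"

lemma linkedE:
  assumes "linked E W" "A \<noteq> {}" "A \<subset> W"
  obtains a b where "a \<in> A" "b \<in> W - A" "(a, b) \<in> E"
  using assms unfolding linked_def by blast

lemma linked_singleton: "linked E {x}"
  by (auto simp: linked_def)

lemma linked_cross:
  assumes "linked E W" "W \<inter> A \<noteq> {}" "\<not> W \<subseteq> A"
  obtains a b where "a \<in> W \<inter> A" "b \<in> W - A" "(a, b) \<in> E"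
proof -
  have "W \<inter> A \<subset> W" using assms(3) by blast
  then obtain a b where "a \<in> W \<inter> A" "b \<in> W - W \<inter> A" "(a, b) \<in> E"
    using linkedE[OF assms(1,2)] by metis
  then show thesis using that[of a b] by simp
qed

lemma linked_Union:
  assumes "F \<noteq> {}" "\<And>W. W \<in> F \<Longrightarrow> linked E W \<and> x \<in> W"
  shows "linked E (\<Union>F)"
  unfolding linked_def
proof (intro conjI allI impI)
  show "\<Union>F \<noteq> {}" using assms by fast
  fix A assume A: "A \<noteq> {} \<and> A \<subset> \<Union>F"
  \<comment> \<open>Some member is split by \<open>A\<close>: if \<open>x\<close> lies in
    \<open>A\<close>, one that leaves \<open>A\<close>; otherwise, one that meets \<open>A\<close>.
    The common point \<open>x\<close> supplies the other half.\<close>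
  obtain W where W: "W \<in> F" "W \<inter> A \<noteq> {}" "\<not> W \<subseteq> A"
  proof (cases "x \<in> A")
    case True
    obtain W where "W \<in> F" "\<not> W \<subseteq> A" using A by blast
    then show thesis using that[of W] True assms(2)[of W] by blast
  next
    case False
    obtain W where "W \<in> F" "W \<inter> A \<noteq> {}" using A by blast
    then show thesis using that[of W] False assms(2)[of W] by blast
  qed
  obtain a b where "a \<in> W \<inter> A" "b \<in> W - A" "(a, b) \<in> E"
    using linked_cross[of E W A] W assms(2)[OF W(1)] by metis
  then show "\<exists>a\<in>A. \<exists>b\<in>\<Union>F - A. (a, b) \<in> E" using W(1) by blast
qed

lemma linked_insert:
  assumes "sym E" "linked E W" "a \<in> W" "(a, b) \<in> E"
  shows "linked E (insert b W)"
  unfolding linked_def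
proof (intro conjI allI impI)
  show "insert b W \<noteq> {}" by simp
  fix A assume A: "A \<noteq> {} \<and> A \<subset> insert b W"
  show "\<exists>x\<in>A. \<exists>y\<in>insert b W - A. (x, y) \<in> E"
  proof (cases "W \<inter> A = {} \<or> W \<subseteq> A")
    case True
    \<comment> \<open>When \<open>A\<close> does not split \<open>W\<close>, it either equals
      \<open>{b}\<close> or contains \<open>W\<close> but not \<open>b\<close>; the edge between
      \<open>a\<close> and \<open>b\<close> then crosses the cut.\<close>
    then have "A = {b} \<and> a \<notin> A \<or> a \<in> A \<and> b \<notin> A" using A assms(3) by blast
    then show ?thesis using assms(1,3,4) by (auto dest: symD)
  next
    case False
    then obtain x y where "x \<in> W \<inter> A" "y \<in> W - A" "(x, y) \<in> E"
      using linked_cross[OF assms(2), of A] by metis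
    then show ?thesis by blast
  qed
qed

section \<open>Components of induced subgraphs\<close>

definition component :: "('a \<times> 'a) set \<Rightarrow> 'a set \<Rightarrow> 'a \<Rightarrow> 'a set" where
  "component E S x = \<Union>{W. W \<subseteq> S \<and> linked E W \<and> x \<in> W}"

lemma component_subset: "component E S x \<subseteq> S"
  by (auto simp: component_def)

lemma linked_component: "x \<in> S \<Longrightarrow> linked E (component E S x)"
  unfolding component_def
proof (rule linked_Union[where x = x])
  assume "x \<in> S"
  then have "{x} \<in> {W. W \<subseteq> S \<and> linked E W \<and> x \<in> W}" using linked_singleton[of E x] by simp
  then show "{W. W \<subseteq> S \<and> linked E W \<and> x \<in> W} \<noteq> {}" by (metis empty_iff)
qed simp

lemma component_self: "x \<in> S \<Longrightarrow> x \<in> component E S x"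
  unfolding component_def using linked_singleton[of E x] by (intro UnionI[of "{x}"]) auto

lemma component_maximal: "W \<subseteq> S \<Longrightarrow> linked E W \<Longrightarrow> x \<in> W \<Longrightarrow> W \<subseteq> component E S x"
  unfolding component_def by (rule Union_upper) simp

lemma component_eq:
  assumes "y \<in> component E S x"
  shows "component E S y = component E S x"
proof -
  \<comment> \<open>A component taken at a point outside \<open>S\<close> is an empty union, so
    having a member forces \<open>x\<close> into \<open>S\<close>.\<close>
  have x: "x \<in> S" using assms by (auto simp: component_def)
  have "component E S x \<subseteq> component E S y"
    by (rule component_maximal[OF component_subset linked_component[OF x] assms])
  then have "x \<in> component E S y" using component_self[OF x] by blast
  moreover have y: "y \<in> S" using assms component_subset by fast
  ultimately have "component E S y \<subseteq> component E S x"
    by (intro component_maximal[OF component_subset linked_component[OF y]])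
  then show ?thesis using \<open>component E S x \<subseteq> component E S y\<close> by blast
qed

lemma component_closed:
  assumes "sym E" "a \<in> component E S x" "(a, b) \<in> E" "b \<in> S"
  shows "b \<in> component E S x"
proof -
  have "x \<in> S" using assms(2) by (auto simp: component_def)
  then have "linked E (insert b (component E S x))"
    using linked_insert[OF assms(1) linked_component assms(2,3)] by blast
  then show ?thesis
    using component_maximal[of "insert b (component E S x)" S E x] component_self[OF \<open>x \<in> S\<close>]
      component_subset[of E S x] assms(4) by blast
qed

text \<open>The vertices of \<open>W\<close> that end a path from \<open>v\<close> form a set that
  no edge can leave: prefixes of a path to \<open>a\<close> are paths, so an outside neighbor
  \<open>b\<close> of \<open>a\<close> is not on that path and can be appended to it.\<close>

lemma linked_path:
  assumes "linked E W" "v \<in> W" "d \<in> W"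
  obtains p where "p \<noteq> []" "hd p = v" "last p = d" "distinct p" "set p \<subseteq> W"
    "walk_in E p"
proof -
  let ?path = "\<lambda>y p. p \<noteq> [] \<and> hd p = v \<and> last p = y \<and> distinct p \<and> set p \<subseteq> W \<and>
    walk_in E p"
  define A where "A = {y \<in> W. \<exists>p. ?path y p}"
  have "?path v [v]" using assms by simp
  then have vA: "v \<in> A" unfolding A_def using assms by blast
  have "A = W"
  proof (rule ccontr)
    assume "A \<noteq> W"
    then have "A \<subset> W" by (auto simp: A_def)
    then obtain a b where ab: "a \<in> A" "b \<in> W - A" "(a, b) \<in> E"
      using linkedE[OF assms(1), of A] vA by blast
    then obtain p where p: "?path a p" by (auto simp: A_def)
    have "set p \<subseteq> A"
    proof
      fix y assume y: "y \<in> set p"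
      then obtain q r where qr: "p = q @ y # r" by (meson split_list)
      have "?path y (q @ [y])"
        using p unfolding qr by (auto simp: successively_append_iff hd_append)
      moreover have "y \<in> W" using p y by blast
      ultimately show "y \<in> A" unfolding A_def by blast
    qed
    then have "b \<notin> set p" using ab by blast
    then have "?path b (p @ [b])" using p ab by (auto simp: successively_append_iff)
    then show False using ab unfolding A_def by blast
  qed
  then show thesis using assms that unfolding A_def by blast
qed

section \<open>Centered colorings of vertex sets with a fixed palette\<close>

definition centered_within :: "('a \<times> 'a) set \<Rightarrow> 'a set \<Rightarrow> nat \<Rightarrow> bool" where
  "centered_within E S n \<longleftrightarrow>
     (\<exists>c. c ` S \<subseteq> {0..<int n} \<and> (\<forall>W. W \<subseteq> S \<and> linked E W \<longrightarrow> has_unique_color c W))"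

lemma centered_within_mono: "centered_within E S n \<Longrightarrow> R \<subseteq> S \<Longrightarrow> centered_within E R n"
proof -
  assume "centered_within E S n" and RS: "R \<subseteq> S"
  then obtain c where c: "c ` S \<subseteq> {0..<int n}"
    "\<forall>W. W \<subseteq> S \<and> linked E W \<longrightarrow> has_unique_color c W"
    unfolding centered_within_def by (elim exE conjE)
  have "c ` R \<subseteq> {0..<int n}" using c(1) RS by blast
  moreover have "\<forall>W. W \<subseteq> R \<and> linked E W \<longrightarrow> has_unique_color c W" using c(2) RS by (meson subset_trans)
  ultimately show "centered_within E R n" unfolding centered_within_def by (intro exI conjI)
qed

text \<open>Components can share the palette, because a linked subset of \<open>S\<close> lies in a
  single component. Consequently a set for which \<open>n\<close> colors do not suffice has a linked
  subset for which they do not suffice either.\<close>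

lemma centered_within_components:
  assumes "\<And>C. C \<subseteq> S \<Longrightarrow> linked E C \<Longrightarrow> centered_within E C n"
  shows "centered_within E S n"
proof -
  let ?good = "\<lambda>C c. c ` C \<subseteq> {0..<int n} \<and> (\<forall>W. W \<subseteq> C \<and> linked E W \<longrightarrow> has_unique_color c W)"
  have "\<forall>C. C \<subseteq> S \<and> linked E C \<longrightarrow> (\<exists>c. ?good C c)"
    using assms unfolding centered_within_def by blast
  then obtain col where col: "\<And>C. C \<subseteq> S \<Longrightarrow> linked E C \<Longrightarrow> ?good C (col C)"
    by metis
  define c where "c x = col (component E S x) x" for x
  have "c ` S \<subseteq> {0..<int n}"
    using col[OF component_subset linked_component] component_self unfolding c_def
    by (smt (verit, best) image_subset_iff)
  moreover have "has_unique_color c W" if W: "W \<subseteq> S" "linked E W" for W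
  proof -
    obtain x where x: "x \<in> W" using W by (auto simp: linked_def)
    let ?C = "component E S x"
    have WC: "W \<subseteq> ?C" by (rule component_maximal[OF W x])
    have "c y = col ?C y" if "y \<in> W" for y
      using component_eq[of y E S x] WC that by (auto simp: c_def)
    moreover have "has_unique_color (col ?C) W"
      using col[OF component_subset linked_component[of x S E]] W WC x by blast
    ultimately show ?thesis by (auto simp: has_unique_color_def)
  qed
  ultimately show ?thesis unfolding centered_within_def by blast
qed

text \<open>The palette is an initial segment, so \<open>int n\<close> is a fresh color that can be
  reserved for \<open>x\<close>. A linked set through \<open>x\<close> then has \<open>x\<close> as
  its uniquely colored vertex.\<close>

lemma centered_within_insert:
  assumes "centered_within E (S - {x}) n"
  shows "centered_within E S (Suc n)"
proof -
  obtain c where c: "c ` (S - {x}) \<subseteq> {0..<int n}"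
    "\<forall>W. W \<subseteq> S - {x} \<and> linked E W \<longrightarrow> has_unique_color c W"
    using assms unfolding centered_within_def by (elim exE conjE)
  have less: "0 \<le> c y \<and> c y < int n" if "y \<in> S" "y \<noteq> x" for y
    using c(1) that by (force simp: image_subset_iff)
  have cS: "(c(x := int n)) ` S \<subseteq> {0..<int (Suc n)}"
  proof (intro image_subsetI)
    fix y assume "y \<in> S"
    then show "(c(x := int n)) y \<in> {0..<int (Suc n)}" using less[of y] by auto
  qed
  have "has_unique_color (c(x := int n)) W" if W: "W \<subseteq> S" "linked E W" for W
  proof (cases "x \<in> W")
    case True
    have "y = x" if "y \<in> W" "(c(x := int n)) y = int n" for y
      using less[of y] that W by (auto split: if_splits)
    then show ?thesis using True unfolding has_unique_color_def by (metis fun_upd_same)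
  next
    case False
    then have "has_unique_color c W" using c(2) W by (metis subset_Diff_insert Diff_empty)
    then show ?thesis using False by (auto simp: has_unique_color_def)
  qed
  then show ?thesis using cS unfolding centered_within_def by (metis (no_types, lifting))
qed

lemma centered_within_Diff:
  assumes "finite B" "centered_within E (S - B) n" "card B \<le> K"
  shows "centered_within E S (n + K)"
proof -
  have "centered_within E S (n + card B)"
    using assms(1,2)
  proof (induction B arbitrary: S)
    case empty
    then show ?case by simp
  next
    case (insert x B)
    have "S - insert x B = S - {x} - B" by blast
    then have "centered_within E (S - {x}) (n + card B)" using insert by metis
    then show ?case using centered_within_insert insert by fastforce
  qed
  then obtain c where "c ` S \<subseteq> {0..<int (n + card B)}"
    "\<forall>W. W \<subseteq> S \<and> linked E W \<longrightarrow> has_unique_color c W"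
    unfolding centered_within_def by blast
  moreover have "{0..<int (n + card B)} \<subseteq> {0..<int (n + K)}" using assms(3) by auto
  ultimately show ?thesis unfolding centered_within_def by (meson subset_trans)
qed

lemma centered_within_zero: "centered_within E S 0 \<longleftrightarrow> S = {}"
proof
  assume "centered_within E S 0"
  then show "S = {}" by (auto simp: centered_within_def)
next
  assume "S = {}"
  moreover have "\<not> linked E {}" by (simp add: linked_def)
  ultimately show "centered_within E S 0" by (simp add: centered_within_def)
qed

subsection \<open>Subtrees and tree decompositions\<close>

text \<open>Relative to a vertex set, so that it passes to subsets in the induction of
  \<open>helly_acyclic\<close>. The bound 3 keeps a single edge, present in both directions, from
  counting as a cycle.\<close>

definition acyclic_on :: "('a \<times> 'a) set \<Rightarrow> 'a set \<Rightarrow> bool" where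
  "acyclic_on E N \<longleftrightarrow> (\<forall>p. distinct p \<and> set p \<subseteq> N \<and> walk_in E p \<and> 3 \<le> length p \<longrightarrow> (last p, hd p) \<notin> E)"

text \<open>The first vertex of a longest path has this property: by maximality all its neighbors
  lie on the path, and a neighbor beyond the second vertex would close a cycle.\<close>

lemma acyclic_leaf:
  assumes "sym E" "\<And>x. (x, x) \<notin> E" "finite N" "N \<noteq> {}"
    and acyclic: "acyclic_on E N"
  obtains x where "x \<in> N" "\<forall>a\<in>N. \<forall>b\<in>N. (x, a) \<in> E \<and> (x, b) \<in> E \<longrightarrow> a = b"
proof -
  let ?path = "\<lambda>p. p \<noteq> [] \<and> distinct p \<and> set p \<subseteq> N \<and> walk_in E p"
  obtain z where "z \<in> N" using assms(4) by blast
  then have "?path [z]" by simp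
  moreover have "\<forall>p. ?path p \<longrightarrow> length p < Suc (card N)"
    by (metis assms(3) card_mono distinct_card le_imp_less_Suc)
  ultimately obtain p where p: "?path p" and longest: "\<And>q. ?path q \<Longrightarrow> length q \<le> length p"
    using ex_has_greatest_nat[of ?path "[z]" length "Suc (card N)"] by blast
  obtain x q where xq: "p = x # q" using p by (cases p) auto
  have nb: "q \<noteq> [] \<and> a = hd q" if a: "a \<in> N" "(x, a) \<in> E" for a
  proof -
    have "(a, x) \<in> E" using a assms(1) by (auto dest: symD)
    have "a \<in> set p"
    proof (rule ccontr)
      assume "a \<notin> set p"
      then have "?path (a # p)" using p a \<open>(a, x) \<in> E\<close> unfolding xq by simp
      then show False using longest[of "a # p"] by simp
    qed
    moreover have "a \<noteq> x" using assms(2) a by blast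
    ultimately have "a \<in> set q" by (simp add: xq)
    then obtain q1 q2 where q: "q = q1 @ a # q2" by (meson split_list)
    have "q1 = []"
    proof (rule ccontr)
      assume "q1 \<noteq> []"
      then have "3 \<le> length (x # q1 @ [a])" by (cases q1) auto
      moreover have "walk_in E ((x # q1 @ [a]) @ q2)" using p unfolding xq q by simp
      then have "walk_in E (x # q1 @ [a])" using successively_append_iff by blast
      moreover have "distinct (x # q1 @ [a])" "set (x # q1 @ [a]) \<subseteq> N"
        using p unfolding xq q by auto
      ultimately have "(last (x # q1 @ [a]), hd (x # q1 @ [a])) \<notin> E"
        using acyclic unfolding acyclic_on_def by blast
      then show False using \<open>(a, x) \<in> E\<close> by simp
    qed
    then show ?thesis using q by simp
  qed
  show thesis
  proof (rule that)
    show "x \<in> N" using p xq by simp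
    show "\<forall>a\<in>N. \<forall>b\<in>N. (x, a) \<in> E \<and> (x, b) \<in> E \<longrightarrow> a = b"
      using nb by metis
  qed
qed

lemma linked_remove_leaf:
  assumes "sym E" "linked E W" "W \<noteq> {x}"
    and leaf: "\<forall>a\<in>W. \<forall>b\<in>W. (x, a) \<in> E \<and> (x, b) \<in> E \<longrightarrow> a = b"
  shows "linked E (W - {x})"
  unfolding linked_def
proof (intro conjI allI impI)
  show "W - {x} \<noteq> {}" using assms(2,3) by (auto simp: linked_def)
  fix A assume A: "A \<noteq> {} \<and> A \<subset> W - {x}"
  \<comment> \<open>The vertex \<open>x\<close> joins \<open>A\<close> exactly when it has a
    neighbor there. Having at most one neighbor, it is then not an end of the edge crossing the cut,
    so this edge survives the removal of \<open>x\<close>.\<close>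
  let ?A = "if \<exists>m\<in>A. (x, m) \<in> E then insert x A else A"
  have "W \<inter> ?A \<noteq> {}" "\<not> W \<subseteq> ?A" using A by auto
  then obtain a b where ab: "a \<in> W \<inter> ?A" "b \<in> W - ?A" "(a, b) \<in> E"
    by (rule linked_cross[OF assms(2)])
  show "\<exists>a\<in>A. \<exists>b\<in>W - {x} - A. (a, b) \<in> E"
  proof (cases "\<exists>m\<in>A. (x, m) \<in> E")
    case True
    then obtain m where m: "m \<in> A" "(x, m) \<in> E" by blast
    have b: "b \<in> W" "b \<noteq> x" "b \<notin> A" "a \<in> insert x A" using ab True by auto
    have "a \<noteq> x" using leaf m b ab(3) A by blast
    then show ?thesis using ab(3) b by blast
  next
    case False
    then have "a \<in> A" "b \<in> W - A" using ab by auto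
    moreover have "b \<noteq> x" using ab(3) False \<open>a \<in> A\<close> assms(1) by (auto dest: symD)
    ultimately show ?thesis using ab(3) by blast
  qed
qed

text \<open>Helly property of subtrees, by deleting a leaf \<open>x\<close> from \<open>N\<close>
  and from all members. Members that met only in \<open>x\<close> still meet afterwards: being
  linked and different from \<open>{x}\<close>, they contain a neighbor of \<open>x\<close>, and
  there is only one.\<close>

lemma helly_acyclic:
  assumes "sym E" "\<And>x. (x, x) \<notin> E" "finite N" "N \<noteq> {}"
    and "acyclic_on E N"
    and "\<And>A. A \<in> F \<Longrightarrow> A \<subseteq> N \<and> linked E A"
    and "\<And>A B. A \<in> F \<Longrightarrow> B \<in> F \<Longrightarrow> A \<inter> B \<noteq> {}"
  shows "\<exists>x\<in>N. \<forall>A\<in>F. x \<in> A"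
  using assms(3-)
proof (induction "card N" arbitrary: N F rule: less_induct)
  case less
  obtain x where x: "x \<in> N"
    and leaf: "\<forall>a\<in>N. \<forall>b\<in>N. (x, a) \<in> E \<and> (x, b) \<in> E \<longrightarrow> a = b"
    by (rule acyclic_leaf[OF assms(1,2) less.prems(1,2,3)])
  show ?case
  \<comment> \<open>In these cases deletion would produce an empty member or an empty vertex set;
    here \<open>x\<close> itself lies in all members.\<close>
  proof (cases "{x} \<in> F \<or> N = {x}")
    case True
    have "x \<in> A" if A: "A \<in> F" for A
    proof (cases "{x} \<in> F")
      case True
      then show ?thesis using less.prems(5)[OF A True] by blast
    next
      case False
      then have "N = {x}" using \<open>{x} \<in> F \<or> N = {x}\<close> by blast
      then show ?thesis using less.prems(4)[OF A] by (auto simp: linked_def)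
    qed
    then show ?thesis using x by blast
  next
    case False
    define F' where "F' = (\<lambda>A. A - {x}) ` F"
    have nb: "\<exists>m. m \<in> A - {x} \<and> (x, m) \<in> E" if "A \<in> F" "x \<in> A" for A
    proof -
      have "A \<noteq> {x}" using that(1) False by blast
      then have "A \<inter> {x} \<noteq> {}" "\<not> A \<subseteq> {x}" using that(2) by blast+
      moreover have "linked E A" using less.prems(4)[OF that(1)] by blast
      ultimately obtain a m where "a \<in> A \<inter> {x}" "m \<in> A - {x}" "(a, m) \<in> E"
        using linked_cross[of E A "{x}"] by (metis (no_types, lifting))
      then show ?thesis by blast
    qed
    have "\<exists>y\<in>N - {x}. \<forall>A\<in>F'. y \<in> A"
    proof (rule less.hyps)
      show "card (N - {x}) < card N" using x less.prems(1) by (rule card_Diff1_less[rotated])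
      show "finite (N - {x})" using less.prems(1) by simp
      show "N - {x} \<noteq> {}" using False x by blast
      show "acyclic_on E (N - {x})" using less.prems(3) unfolding acyclic_on_def by blast
      show "A \<subseteq> N - {x} \<and> linked E A" if "A \<in> F'" for A
      proof -
        obtain A' where A': "A' \<in> F" "A = A' - {x}" using \<open>A \<in> F'\<close> unfolding F'_def by blast
        have "A' \<noteq> {x}" using A' False by blast
        moreover have "A' \<subseteq> N" "linked E A'" using less.prems(4)[OF A'(1)] by auto
        ultimately show ?thesis
          using linked_remove_leaf[OF assms(1), of A' x] leaf A'(2)
          by (metis Diff_mono order_refl subsetD)
      qed
      show "A \<inter> B \<noteq> {}" if "A \<in> F'" "B \<in> F'" for A B
      proof -
        obtain A' B' where AB: "A' \<in> F" "A = A' - {x}" "B' \<in> F" "B = B' - {x}"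
          using \<open>A \<in> F'\<close> \<open>B \<in> F'\<close> unfolding F'_def by blast
        obtain y where y: "y \<in> A'" "y \<in> B'" using less.prems(5)[OF AB(1,3)] by blast
        show ?thesis
        proof (cases "y = x")
          case True
          obtain m m' where m: "m \<in> A' - {x}" "(x, m) \<in> E" "m' \<in> B' - {x}" "(x, m') \<in> E"
            using nb[OF AB(1)] nb[OF AB(3)] y True by blast
          moreover have "m \<in> N" "m' \<in> N" using m less.prems(4) AB(1,3) by blast+
          ultimately have "m = m'" using leaf by blast
          then show ?thesis using AB m by blast
        next
          case False
          then show ?thesis using y AB by blast
        qed
      qed
    qed
    then show ?thesis by (auto simp: F'_def)
  qed
qed

lemma disjoint_uncentered_sets:
  fixes B :: "'b \<Rightarrow> 'a set"
  assumes E: "sym E" and T: "sym T" "\<And>x. (x, x) \<notin> T" "finite N" "N \<noteq> {}"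
    and acyclic: "acyclic_on T N"
    and bags: "\<And>t. t \<in> N \<Longrightarrow> finite (B t) \<and> card (B t) \<le> K"
    and edge_bag: "\<And>u v. (u, v) \<in> E \<Longrightarrow> \<exists>t\<in>N. u \<in> B t \<and> v \<in> B t"
    and vertex_bags: "\<And>v. v \<in> V \<Longrightarrow> linked T {t \<in> N. v \<in> B t}"
    and H: "H \<subseteq> V" "\<not> centered_within E H (n + K)"
  obtains C D where "C \<subseteq> H" "D \<subseteq> H" "C \<inter> D = {}" "linked E C" "linked E D"
    "\<not> centered_within E C n" "\<not> centered_within E D n"
proof (rule ccontr)
  assume not_split: "\<not> thesis"
  note split = that
  have meet: "C \<inter> D \<noteq> {}" if "C \<subseteq> H" "D \<subseteq> H" "linked E C" "linked E D"
    "\<not> centered_within E C n" "\<not> centered_within E D n" for C D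
    using split[OF that(1,2) _ that(3-)] not_split by blast
  define big where "big C \<longleftrightarrow> C \<subseteq> H \<and> linked E C \<and> \<not> centered_within E C n" for C
  define trace where "trace C = {t \<in> N. B t \<inter> C \<noteq> {}}" for C
  have trace_nonempty: "\<exists>t\<in>N. v \<in> B t" if "v \<in> H" for v
    using vertex_bags[of v] H(1) that by (auto simp: linked_def)
  have linked_trace: "linked T (trace C)" if C: "big C" for C
    unfolding linked_def
  proof (intro conjI allI impI)
    obtain v where "v \<in> C" using C by (auto simp: big_def linked_def)
    then show "trace C \<noteq> {}" using trace_nonempty[of v] C by (auto simp: big_def trace_def)
    fix A assume A: "A \<noteq> {} \<and> A \<subset> trace C"
    show "\<exists>a\<in>A. \<exists>b\<in>trace C - A. (a, b) \<in> T"
    proof (rule ccontr)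
      assume no: "\<not> ?thesis"
      \<comment> \<open>If no tree edge leaves \<open>A\<close> inside the trace, then every vertex
        of \<open>M\<close> has all its nodes in \<open>A\<close>, since these nodes are linked. An
        edge of the graph from \<open>M\<close> to \<open>C - M\<close> lies in a common bag, which
        contradicts this.\<close>
      define M where "M = {v \<in> C. \<exists>t\<in>A. v \<in> B t}"
      have in_A: "t \<in> A" if v: "v \<in> M" and t: "t \<in> N" "v \<in> B t" for v t
      proof (rule ccontr)
        let ?W = "{t \<in> N. v \<in> B t}"
        assume "t \<notin> A"
        then have "\<not> ?W \<subseteq> A" using t by blast
        moreover have "?W \<inter> A \<noteq> {}" using v A by (auto simp: M_def trace_def)
        moreover have "linked T ?W" using vertex_bags[of v] v C H(1) by (auto simp: M_def big_def)
        ultimately obtain a b where "a \<in> ?W \<inter> A" "b \<in> ?W - A" "(a, b) \<in> T"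
          using linked_cross[of T ?W A] by (metis (no_types, lifting))
        moreover have "?W \<subseteq> trace C" using v by (auto simp: M_def trace_def)
        ultimately show False using no by blast
      qed
      obtain t where "t \<in> A" using A by blast
      then have "C \<inter> M \<noteq> {}" using A by (auto simp: M_def trace_def)
      moreover have "\<not> C \<subseteq> M"
      proof
        assume "C \<subseteq> M"
        then have "trace C \<subseteq> A" using in_A by (auto simp: trace_def)
        then show False using A by blast
      qed
      moreover have "linked E C" using C by (simp add: big_def)
      ultimately obtain u v where uv: "u \<in> C \<inter> M" "v \<in> C - M" "(u, v) \<in> E"
        using linked_cross[of E C M] by (metis (no_types, lifting))
      obtain s where s: "s \<in> N" "u \<in> B s" "v \<in> B s" using edge_bag[OF uv(3)] by blast
      have "s \<in> A" using in_A[of u s] uv s by blast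
      then show False using uv s by (auto simp: M_def)
    qed
  qed
  have "\<exists>t\<in>N. \<forall>A\<in>trace ` Collect big. t \<in> A"
  proof (rule helly_acyclic[OF T acyclic])
    show "A \<subseteq> N \<and> linked T A" if "A \<in> trace ` Collect big" for A
      using that linked_trace by (auto simp: trace_def)
    show "A \<inter> A' \<noteq> {}" if "A \<in> trace ` Collect big" "A' \<in> trace ` Collect big" for A A'
    proof -
      obtain C D where CD: "big C" "big D" "A = trace C" "A' = trace D"
        using \<open>A \<in> _\<close> \<open>A' \<in> _\<close> by blast
      then obtain v where v: "v \<in> C" "v \<in> D" using meet[of C D] by (auto simp: big_def)
      then obtain t where "t \<in> N" "v \<in> B t" using trace_nonempty[of v] CD by (auto simp: big_def)
      then show ?thesis using CD v by (auto simp: trace_def)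
    qed
  qed
  then obtain t where t: "t \<in> N" "\<And>C. big C \<Longrightarrow> B t \<inter> C \<noteq> {}" by (auto simp: trace_def)
  \<comment> \<open>A linked set avoiding the bag \<open>B t\<close> is not big, so \<open>n\<close>
    colors suffice for every linked part of \<open>H - B t\<close>.\<close>
  have "centered_within E (H - B t) n"
  proof (rule centered_within_components)
    fix C assume "C \<subseteq> H - B t" "linked E C"
    then show "centered_within E C n" using t(2)[of C] unfolding big_def by blast
  qed
  then show False using centered_within_Diff[of "B t" E H n K] bags[OF t(1)] H(2) by blast
qed

subsection \<open>Large binary trees\<close>

text \<open>\<open>C'\<close> is the component of \<open>H - D\<close> containing \<open>C\<close>,
  and \<open>D'\<close> is the rest. The rest is linked because every other component of
  \<open>H - D\<close> is joined to \<open>D\<close> by an edge, \<open>H\<close> being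
  linked.\<close>

lemma linked_partition:
  assumes "sym E" "linked E H" "linked E C" "linked E D" "C \<subseteq> H" "D \<subseteq> H" "C \<inter> D = {}"
  obtains C' D' where "C \<subseteq> C'" "D \<subseteq> D'" "C' \<union> D' = H" "C' \<inter> D' = {}" "linked E C'" "linked E D'"
proof -
  obtain c where c: "c \<in> C" using assms(3) by (auto simp: linked_def)
  then have cH: "c \<in> H - D" using assms(5,7) by blast
  define C' where "C' = component E (H - D) c"
  define D' where "D' = H - C'"
  have C'H: "C' \<subseteq> H - D" unfolding C'_def by (rule component_subset)
  have "C \<subseteq> H - D" using assms(5,7) by blast
  then have CC': "C \<subseteq> C'" unfolding C'_def using component_maximal[of C "H - D" E c] assms(3) c by blast
  have DD': "D \<subseteq> D'" using C'H assms(6) unfolding D'_def by blast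
  \<comment> \<open>An edge leaving \<open>X\<close> inside \<open>H\<close> cannot end in
    \<open>C'\<close>, since \<open>X\<close> avoids \<open>D\<close> and \<open>C'\<close> is
    closed under adjacency in \<open>H - D\<close>.\<close>
  have escape: "\<exists>x\<in>X. \<exists>y\<in>D' - X. (x, y) \<in> E" if X: "X \<noteq> {}" "X \<subseteq> D'" "X \<inter> D = {}" for X
  proof -
    have "X \<subset> H" using X C'H CC' c unfolding D'_def by blast
    then obtain x y where xy: "x \<in> X" "y \<in> H - X" "(x, y) \<in> E"
      using linkedE[OF assms(2) X(1)] by metis
    have "y \<notin> C'"
    proof
      assume "y \<in> C'"
      moreover have "(y, x) \<in> E" using xy(3) assms(1) by (auto dest: symD)
      moreover have "x \<in> H - D" using xy(1) X(2,3) unfolding D'_def by blast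
      ultimately have "x \<in> C'" using component_closed[OF assms(1), of y "H - D" c x] unfolding C'_def by blast
      then show False using xy(1) X(2) unfolding D'_def by blast
    qed
    then show ?thesis using xy unfolding D'_def by blast
  qed
  have "linked E D'"
    unfolding linked_def
  proof (intro conjI allI impI)
    show "D' \<noteq> {}" using DD' assms(4) by (auto simp: linked_def)
    fix A assume A: "A \<noteq> {} \<and> A \<subset> D'"
    consider "D \<inter> A = {}" | "D \<subseteq> A" | "D \<inter> A \<noteq> {}" "\<not> D \<subseteq> A" by blast
    then show "\<exists>a\<in>A. \<exists>b\<in>D' - A. (a, b) \<in> E"
    proof cases
      case 1
      then show ?thesis using escape[of A] A by blast
    next
      case 2
      have "D' - A \<noteq> {}" "(D' - A) \<inter> D = {}" using A 2 by blast+
      then obtain x y where "x \<in> D' - A" "y \<in> D' - (D' - A)" "(x, y) \<in> E"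
        using escape[of "D' - A"] by blast
      then show ?thesis using assms(1) by (auto dest: symD)
    next
      case 3
      then obtain a b where "a \<in> D \<inter> A" "b \<in> D - A" "(a, b) \<in> E"
        by (rule linked_cross[OF assms(4)])
      then show ?thesis using DD' by blast
    qed
  qed
  moreover have "linked E C'" unfolding C'_def by (rule linked_component[OF cH])
  moreover have "C' \<union> D' = H" "C' \<inter> D' = {}" using C'H unfolding D'_def by blast+
  ultimately show thesis using that[of C' D'] CC' DD' by blast
qed

section \<open>Binary trees inside the graph\<close>

fun hangs :: "('a \<times> 'a) set \<Rightarrow> 'a \<Rightarrow> 'a tree \<Rightarrow> bool" where
  "hangs E x Leaf \<longleftrightarrow> True"
| "hangs E x (Node l y r) \<longleftrightarrow> (x, y) \<in> E"

text \<open>\<open>Leaf\<close> is the empty tree and only \<open>Node\<close> carries a vertex, so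
  \<open>size\<close> counts vertices.\<close>

fun embedded :: "('a \<times> 'a) set \<Rightarrow> 'a tree \<Rightarrow> bool" where
  "embedded E Leaf \<longleftrightarrow> True"
| "embedded E (Node l x r) \<longleftrightarrow> embedded E l \<and> embedded E r \<and> hangs E x l \<and> hangs E x r \<and>
     x \<notin> set_tree l \<and> x \<notin> set_tree r \<and> set_tree l \<inter> set_tree r = {}"

text \<open>A path is laid out along the left children, which keeps the right children free for side
  trees. In this shape \<open>rooted_tree_Suc\<close> moves the root to a prescribed vertex.\<close>

fun spine :: "('a \<Rightarrow> 'a tree) \<Rightarrow> 'a tree \<Rightarrow> 'a list \<Rightarrow> 'a tree" where
  "spine \<tau> t [] = t"
| "spine \<tau> t (x # xs) = Node (spine \<tau> t xs) x (\<tau> x)"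

lemma set_tree_spine: "set_tree (spine \<tau> t xs) = set_tree t \<union> set xs \<union> (\<Union>x\<in>set xs. set_tree (\<tau> x))"
  by (induction xs) auto

lemma size_spine:
  "distinct xs \<Longrightarrow> size (spine \<tau> t xs) = size t + (\<Sum>x\<in>set xs. Suc (size (\<tau> x)))"
  by (induction xs) auto

lemma embedded_spine:
  assumes "distinct xs" "walk_in E xs" "embedded E t" "xs \<noteq> [] \<Longrightarrow> hangs E (last xs) t"
    and "\<forall>x\<in>set xs. embedded E (\<tau> x) \<and> hangs E x (\<tau> x) \<and> set_tree (\<tau> x) \<inter> (set xs \<union> set_tree t) = {}"
    and "\<forall>x\<in>set xs. \<forall>y\<in>set xs. x \<noteq> y \<longrightarrow> set_tree (\<tau> x) \<inter> set_tree (\<tau> y) = {}"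
    and "set xs \<inter> set_tree t = {}"
  shows "embedded E (spine \<tau> t xs)"
  using assms
proof (induction xs)
  case Nil
  then show ?case by simp
next
  case (Cons x xs)
  have "embedded E (spine \<tau> t xs)"
  proof (rule Cons.IH)
    show "xs \<noteq> [] \<Longrightarrow> hangs E (last xs) t" using Cons.prems(4) by simp
    show "walk_in E xs" using Cons.prems(2) by (cases xs) auto
  qed (use Cons.prems in auto)
  moreover have "hangs E x (spine \<tau> t xs)"
    using Cons.prems(2,4) by (cases xs) auto
  moreover have "x \<notin> set_tree (spine \<tau> t xs)"
    using Cons.prems unfolding set_tree_spine by auto
  moreover have "set_tree (spine \<tau> t xs) \<inter> set_tree (\<tau> x) = {}"
  proof -
    have "set_tree (\<tau> y) \<inter> set_tree (\<tau> x) = {}" if "y \<in> set xs" for y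
      using Cons.prems(1,6) that by auto
    moreover have "set_tree (\<tau> x) \<inter> (set xs \<union> set_tree t) = {}" using Cons.prems(5) by auto
    ultimately show ?thesis unfolding set_tree_spine by blast
  qed
  ultimately show ?case using Cons.prems(5) by auto
qed

text \<open>\<open>P\<close> stands for the vertex set of a path and \<open>\<tau>\<close> for the
  side trees hung on it. The value \<open>Leaf\<close> elsewhere makes \<open>\<tau>\<close> total,
  so families on disjoint sets can be merged by a case distinction.\<close>

definition attached :: "('a \<times> 'a) set \<Rightarrow> 'a set \<Rightarrow> 'a set \<Rightarrow> ('a \<Rightarrow> 'a tree) \<Rightarrow> bool" where
  "attached E D P \<tau> \<longleftrightarrow>
     (\<forall>p. (p \<notin> P \<inter> D \<longrightarrow> \<tau> p = Leaf) \<and> embedded E (\<tau> p) \<and> hangs E p (\<tau> p) \<and> set_tree (\<tau> p) \<subseteq> D - P) \<and>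
     (\<forall>p q. p \<noteq> q \<longrightarrow> set_tree (\<tau> p) \<inter> set_tree (\<tau> q) = {})"

lemma attached_Leaf: "attached E D P (\<lambda>_. Leaf)"
  by (simp add: attached_def)

lemma attached_single:
  assumes "p \<in> P \<inter> D" "embedded E t" "hangs E p t" "set_tree t \<subseteq> D - P"
  shows "attached E D P ((\<lambda>_. Leaf)(p := t))"
  using assms by (auto simp: attached_def)

lemma attached_union:
  assumes "attached E C P \<sigma>" "attached E D P \<tau>" "C \<inter> D = {}" "C \<subseteq> H" "D \<subseteq> H"
  shows "attached E H P (\<lambda>p. if p \<in> C then \<sigma> p else \<tau> p)"
proof -
  have 1: "p \<notin> P \<inter> C \<longrightarrow> \<sigma> p = Leaf" "embedded E (\<sigma> p)" "hangs E p (\<sigma> p)" "set_tree (\<sigma> p) \<subseteq> C - P"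
    "p \<notin> P \<inter> D \<longrightarrow> \<tau> p = Leaf" "embedded E (\<tau> p)" "hangs E p (\<tau> p)" "set_tree (\<tau> p) \<subseteq> D - P" for p
    using assms(1,2) unfolding attached_def by blast+
  have 2: "p \<noteq> q \<Longrightarrow> set_tree (\<sigma> p) \<inter> set_tree (\<sigma> q) = {}" "p \<noteq> q \<Longrightarrow> set_tree (\<tau> p) \<inter> set_tree (\<tau> q) = {}"
    for p q using assms(1,2) unfolding attached_def by blast+
  have 3: "set_tree (\<sigma> p) \<inter> set_tree (\<tau> q) = {}" for p q
    using 1(4)[of p] 1(8)[of q] assms(3) by blast
  show ?thesis
    unfolding attached_def
  proof (intro conjI allI impI)
    fix p
    let ?t = "if p \<in> C then \<sigma> p else \<tau> p"
    show "?t = Leaf" if "p \<notin> P \<inter> H" using 1(1,5)[of p] that assms(4,5) by auto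
    show "embedded E ?t" "hangs E p ?t" using 1[of p] by auto
    show "set_tree ?t \<subseteq> H - P" using 1(4,8)[of p] assms(4,5) by auto
    show "set_tree ?t \<inter> set_tree (if q \<in> C then \<sigma> q else \<tau> q) = {}" if "p \<noteq> q" for q
      using 2[OF that] 3[of p q] 3[of q p] by auto
  qed
qed

text \<open>This is all that the construction of large trees uses of a tree decomposition with bags
  of size at most \<open>K\<close>.\<close>

locale splittable =
  fixes E :: "('a \<times> 'a) set" and V :: "'a set" and K :: nat
  assumes sym: "sym E" and finite: "finite V"
    and split: "\<And>H n. H \<subseteq> V \<Longrightarrow> \<not> centered_within E H (n + K) \<Longrightarrow>
      \<exists>C D. C \<subseteq> H \<and> D \<subseteq> H \<and> C \<inter> D = {} \<and> linked E C \<and> linked E D \<and>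
        \<not> centered_within E C n \<and> \<not> centered_within E D n"
begin

text \<open>Proved by a joint induction with \<open>hanging_trees\<close>. The root \<open>v\<close>
  is prescribed so that the tree can be attached at the end of an edge entering
  \<open>H\<close>.\<close>

definition rooted_tree :: "nat \<Rightarrow> bool" where
  "rooted_tree m \<longleftrightarrow> (\<forall>H v. H \<subseteq> V \<and> linked E H \<and> v \<in> H \<and> \<not> centered_within E H (m * K) \<longrightarrow>
     (\<exists>l r. embedded E (Node l v r) \<and> set_tree (Node l v r) \<subseteq> H \<and> fib (m + 2) \<le> size (Node l v r)))"

text \<open>The \<open>Suc\<close> counts the vertex that carries the side tree, so the sum is what
  a path on \<open>P\<close> contributes to a \<open>spine\<close>. The index is one lower than in
  \<open>rooted_tree\<close>, so that the two bounds add up by the Fibonacci recurrence.\<close>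

definition hanging_trees :: "nat \<Rightarrow> bool" where
  "hanging_trees m \<longleftrightarrow> (\<forall>D P. D \<subseteq> V \<and> linked E D \<and> D \<inter> P \<noteq> {} \<and> \<not> centered_within E D (m * K) \<longrightarrow>
     (\<exists>\<tau>. attached E D P \<tau> \<and> fib (m + 1) \<le> (\<Sum>p\<in>P \<inter> D. Suc (size (\<tau> p)))))"

lemma rooted_tree_0: "rooted_tree 0"
  unfolding rooted_tree_def
proof (intro allI impI, elim conjE)
  fix H and v :: 'a assume "v \<in> H"
  then show "\<exists>l r. embedded E (Node l v r) \<and> set_tree (Node l v r) \<subseteq> H \<and> fib (0 + 2) \<le> size (Node l v r)"
    by (intro exI[of _ Leaf]) (simp add: numeral_2_eq_2)
qed

lemma hanging_trees_0: "hanging_trees 0"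
  unfolding hanging_trees_def
proof (intro allI impI, elim conjE)
  fix D P assume D: "D \<subseteq> V" "D \<inter> P \<noteq> {}"
  have "finite (P \<inter> D)" using D(1) finite finite_subset by blast
  moreover have "P \<inter> D \<noteq> {}" using D(2) by blast
  ultimately have "1 \<le> card (P \<inter> D)" by (simp add: Suc_leI card_gt_0_iff)
  then show "\<exists>\<tau>. attached E D P \<tau> \<and> fib (0 + 1) \<le> (\<Sum>p\<in>P \<inter> D. Suc (size (\<tau> p)))"
    using attached_Leaf[of E D P] by (intro exI[of _ "\<lambda>_. Leaf"]) simp
qed

text \<open>If \<open>D - P\<close> still needs more than \<open>m * K\<close> colors, one rooted
  tree of rank \<open>m\<close>, hung on a vertex of \<open>P\<close>, is enough. Otherwise every
  subset of \<open>D\<close> needing more colors meets \<open>P\<close>, so the hypothesis applies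
  separately to two disjoint parts of \<open>D\<close>.\<close>

lemma hanging_trees_Suc:
  assumes "rooted_tree m" "hanging_trees m"
  shows "hanging_trees (Suc m)"
  unfolding hanging_trees_def
proof (intro allI impI, elim conjE)
  fix D P assume D: "D \<subseteq> V" "linked E D" "D \<inter> P \<noteq> {}" "\<not> centered_within E D (Suc m * K)"
  have fin: "finite (P \<inter> D)" using D(1) finite finite_subset by blast
  show "\<exists>\<tau>. attached E D P \<tau> \<and> fib (Suc m + 1) \<le> (\<Sum>p\<in>P \<inter> D. Suc (size (\<tau> p)))"
  proof (cases "centered_within E (D - P) (m * K)")
    case False
    then obtain A where A: "A \<subseteq> D - P" "linked E A" "\<not> centered_within E A (m * K)"
      using centered_within_components[of "D - P" E "m * K"] by blast
    obtain a where a: "a \<in> A" using A(2) by (auto simp: linked_def)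
    define C where "C = component E (D - P) a"
    have aDP: "a \<in> D - P" using A(1) a by blast
    have C: "C \<subseteq> D - P" "linked E C"
      unfolding C_def by (rule component_subset, rule linked_component[OF aDP])
    have "A \<subseteq> C" unfolding C_def by (rule component_maximal[OF A(1,2) a])
    then have not_C: "\<not> centered_within E C (m * K)" using A(3) centered_within_mono by blast
    have "C \<noteq> {}" "C \<subset> D" using C D(3) by (auto simp: linked_def)
    then obtain e p where ep: "e \<in> C" "p \<in> D - C" "(e, p) \<in> E" using linkedE[OF D(2)] by metis
    \<comment> \<open>The component \<open>C\<close> is closed under adjacency in
      \<open>D - P\<close>, so an edge leaving it within \<open>D\<close> ends in
      \<open>P\<close>.\<close>
    have "p \<in> P"
    proof (rule ccontr)
      assume "p \<notin> P"
      then have "p \<in> C" using component_closed[OF sym, of e "D - P" a p] ep unfolding C_def by blast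
      then show False using ep by blast
    qed
    have "C \<subseteq> V" using C(1) D(1) by blast
    then obtain l r where t: "embedded E (Node l e r)" "set_tree (Node l e r) \<subseteq> C"
      "fib (m + 2) \<le> size (Node l e r)"
      using assms(1) C(2) ep(1) not_C unfolding rooted_tree_def by meson
    define \<tau> where "\<tau> = (\<lambda>_. Leaf)(p := Node l e r)"
    have "attached E D P \<tau>"
      unfolding \<tau>_def
    proof (rule attached_single[OF _ t(1)])
      show "p \<in> P \<inter> D" using \<open>p \<in> P\<close> ep by blast
      show "hangs E p (Node l e r)" using ep(3) sym by (auto dest: symD)
      show "set_tree (Node l e r) \<subseteq> D - P" using t(2) C(1) by blast
    qed
    moreover have "fib (Suc m + 1) \<le> Suc (size (\<tau> p))" using t(3) by (simp add: \<tau>_def)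
    moreover have "Suc (size (\<tau> p)) \<le> (\<Sum>p\<in>P \<inter> D. Suc (size (\<tau> p)))"
      using member_le_sum[of p "P \<inter> D" "\<lambda>p. Suc (size (\<tau> p))"] fin \<open>p \<in> P\<close> ep by auto
    ultimately show ?thesis by (meson le_trans)
  next
    case True
    have "\<not> centered_within E D (m * K + K)" using D(4) by (simp add: add.commute)
    then obtain A B where AB: "A \<subseteq> D" "B \<subseteq> D" "A \<inter> B = {}" "linked E A" "linked E B"
      "\<not> centered_within E A (m * K)" "\<not> centered_within E B (m * K)"
      using split[OF D(1)] by metis
    have meet: "X \<inter> P \<noteq> {}" if "X \<subseteq> D" "\<not> centered_within E X (m * K)" for X
    proof
      assume "X \<inter> P = {}"
      then have "X \<subseteq> D - P" using that(1) by blast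
      then show False using that(2) True centered_within_mono by blast
    qed
    have "A \<subseteq> V" "B \<subseteq> V" using AB D(1) by blast+
    obtain \<sigma> where \<sigma>: "attached E A P \<sigma>" "fib (m + 1) \<le> (\<Sum>p\<in>P \<inter> A. Suc (size (\<sigma> p)))"
      using assms(2) AB(4,6) meet[OF AB(1,6)] \<open>A \<subseteq> V\<close> unfolding hanging_trees_def by meson
    obtain \<tau> where \<tau>: "attached E B P \<tau>" "fib (m + 1) \<le> (\<Sum>p\<in>P \<inter> B. Suc (size (\<tau> p)))"
      using assms(2) AB(5,7) meet[OF AB(2,7)] \<open>B \<subseteq> V\<close> unfolding hanging_trees_def by meson
    define \<rho> where "\<rho> p = (if p \<in> A then \<sigma> p else \<tau> p)" for p
    \<comment> \<open>The left side is \<open>fib (m + 1) + fib m\<close>, and \<open>fib\<close> is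
      monotone.\<close>
    have "fib (Suc m + 1) \<le> fib (m + 1) + fib (m + 1)"
      using fib_mono[of m "Suc m"] by simp
    also have "\<dots> \<le> (\<Sum>p\<in>P \<inter> A. Suc (size (\<rho> p))) + (\<Sum>p\<in>P \<inter> B. Suc (size (\<rho> p)))"
    proof (rule add_mono)
      have "(\<Sum>p\<in>P \<inter> A. Suc (size (\<rho> p))) = (\<Sum>p\<in>P \<inter> A. Suc (size (\<sigma> p)))"
        by (rule sum.cong) (auto simp: \<rho>_def)
      then show "fib (m + 1) \<le> (\<Sum>p\<in>P \<inter> A. Suc (size (\<rho> p)))" using \<sigma>(2) by simp
      have "(\<Sum>p\<in>P \<inter> B. Suc (size (\<rho> p))) = (\<Sum>p\<in>P \<inter> B. Suc (size (\<tau> p)))"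
        by (rule sum.cong) (use AB(3) in \<open>auto simp: \<rho>_def\<close>)
      then show "fib (m + 1) \<le> (\<Sum>p\<in>P \<inter> B. Suc (size (\<rho> p)))" using \<tau>(2) by simp
    qed
    also have "\<dots> = (\<Sum>p\<in>(P \<inter> A) \<union> (P \<inter> B). Suc (size (\<rho> p)))"
    proof (rule sum.union_disjoint[symmetric])
      show "finite (P \<inter> A)" "finite (P \<inter> B)"
        using \<open>A \<subseteq> V\<close> \<open>B \<subseteq> V\<close> finite finite_subset by blast+
    qed (use AB(3) in blast)
    also have "\<dots> \<le> (\<Sum>p\<in>P \<inter> D. Suc (size (\<rho> p)))"
      by (rule sum_mono2[OF fin]) (use AB in auto)
    finally have "fib (Suc m + 1) \<le> (\<Sum>p\<in>P \<inter> D. Suc (size (\<rho> p)))" .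
    moreover have "attached E D P \<rho>"
      using attached_union[OF \<sigma>(1) \<tau>(1) AB(3,1,2)] unfolding \<rho>_def .
    ultimately show ?thesis by blast
  qed
qed

text \<open>Partition \<open>H\<close> into linked parts \<open>C\<close> and \<open>D\<close>, both
  needing more than \<open>m * K\<close> colors, with \<open>v\<close> in \<open>D\<close>. A path
  in \<open>D\<close> leads from \<open>v\<close> to a vertex adjacent to \<open>C\<close>. Below
  its end hangs a tree of rank \<open>m\<close> in \<open>C\<close>, and side trees in
  \<open>D\<close> hang along it, which gives \<open>fib (m + 2) + fib (m + 1)\<close>
  vertices.\<close>

lemma rooted_tree_Suc:
  assumes "rooted_tree m" "hanging_trees m"
  shows "rooted_tree (Suc m)"
proof -
  have extend: "\<exists>l r. embedded E (Node l v r) \<and> set_tree (Node l v r) \<subseteq> C \<union> D \<and>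
      fib (Suc m + 2) \<le> size (Node l v r)"
    if CD: "C \<union> D \<subseteq> V" "linked E (C \<union> D)" "C \<inter> D = {}" "linked E C" "linked E D"
      "\<not> centered_within E C (m * K)" "\<not> centered_within E D (m * K)" and v: "v \<in> D" for C D v
  proof -
    have "D \<noteq> {}" "D \<subset> C \<union> D" using CD(3,4,5) by (auto simp: linked_def)
    then obtain d w where dw: "d \<in> D" "w \<in> C \<union> D - D" "(d, w) \<in> E" using linkedE[OF CD(2)] by metis
    then have w: "w \<in> C" by blast
    obtain xs where xs: "xs \<noteq> []" "hd xs = v" "last xs = d" "distinct xs" "set xs \<subseteq> D" "walk_in E xs"
      using linked_path[OF CD(5) v dw(1)] by metis
    have CV: "C \<subseteq> V" "D \<subseteq> V" using CD(1) by auto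
    obtain l r where t: "embedded E (Node l w r)" "set_tree (Node l w r) \<subseteq> C"
      "fib (m + 2) \<le> size (Node l w r)"
      using assms(1) CV(1) CD(4,6) w unfolding rooted_tree_def by meson
    have "D \<inter> set xs \<noteq> {}" using xs(1,5) by (cases xs) auto
    then obtain \<tau> where \<tau>: "attached E D (set xs) \<tau>"
      "fib (m + 1) \<le> (\<Sum>p\<in>set xs \<inter> D. Suc (size (\<tau> p)))"
      using assms(2) CV(2) CD(5,7) unfolding hanging_trees_def by meson
    have \<tau>1: "embedded E (\<tau> p)" "hangs E p (\<tau> p)" "set_tree (\<tau> p) \<subseteq> D - set xs" for p
      using \<tau>(1) unfolding attached_def by blast+
    have \<tau>2: "p \<noteq> q \<Longrightarrow> set_tree (\<tau> p) \<inter> set_tree (\<tau> q) = {}" for p q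
      using \<tau>(1) unfolding attached_def by blast
    let ?t = "spine \<tau> (Node l w r) xs"
    have "embedded E ?t"
    proof (rule embedded_spine[OF xs(4,6) t(1)])
      show "hangs E (last xs) (Node l w r)" using dw xs(3) by simp
      show "\<forall>x\<in>set xs. embedded E (\<tau> x) \<and> hangs E x (\<tau> x) \<and>
          set_tree (\<tau> x) \<inter> (set xs \<union> set_tree (Node l w r)) = {}"
        using \<tau>1 t(2) CD(3) by blast
      show "\<forall>x\<in>set xs. \<forall>y\<in>set xs. x \<noteq> y \<longrightarrow> set_tree (\<tau> x) \<inter> set_tree (\<tau> y) = {}"
        using \<tau>2 by blast
      show "set xs \<inter> set_tree (Node l w r) = {}" using xs(5) t(2) CD(3) by blast
    qed
    moreover have "set_tree ?t \<subseteq> C \<union> D"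
      unfolding set_tree_spine using t(2) xs(5) \<tau>1(3) by blast
    moreover have "fib (Suc m + 2) \<le> size ?t"
    proof -
      have "set xs \<inter> D = set xs" using xs(5) by blast
      then have "fib (m + 1) \<le> (\<Sum>p\<in>set xs. Suc (size (\<tau> p)))" using \<tau>(2) by simp
      then show ?thesis unfolding size_spine[OF xs(4)] using t(3) by simp
    qed
    \<comment> \<open>The path starts at \<open>v\<close>, so \<open>v\<close> is the root of the
      spine.\<close>
    moreover obtain ys where "xs = v # ys" using xs(1,2) by (cases xs) auto
    ultimately show ?thesis by auto
  qed
  show ?thesis
    unfolding rooted_tree_def
  proof (intro allI impI, elim conjE)
    fix H v assume H: "H \<subseteq> V" "linked E H" "v \<in> H" "\<not> centered_within E H (Suc m * K)"
    have "\<not> centered_within E H (m * K + K)" using H(4) by (simp add: add.commute)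
    then obtain C0 D0 where CD0: "C0 \<subseteq> H" "D0 \<subseteq> H" "C0 \<inter> D0 = {}" "linked E C0" "linked E D0"
      "\<not> centered_within E C0 (m * K)" "\<not> centered_within E D0 (m * K)"
      using split[OF H(1)] by metis
    obtain C D where CD: "C0 \<subseteq> C" "D0 \<subseteq> D" "C \<union> D = H" "C \<inter> D = {}" "linked E C" "linked E D"
      using linked_partition[OF sym H(2) CD0(4,5,1,2,3)] by metis
    have not: "\<not> centered_within E C (m * K)" "\<not> centered_within E D (m * K)"
      using CD0(6,7) CD(1,2) centered_within_mono by blast+
    show "\<exists>l r. embedded E (Node l v r) \<and> set_tree (Node l v r) \<subseteq> H \<and> fib (Suc m + 2) \<le> size (Node l v r)"
    proof (cases "v \<in> D")
      case True
      then show ?thesis using extend[of C D v] CD H not by simp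
    next
      case False
      then have "v \<in> C" using CD(3) H(3) by blast
      then show ?thesis using extend[of D C v] CD H not by (simp add: Un_commute Int_commute)
    qed
  qed
qed

lemma embedded_tree_exists:
  assumes "H \<subseteq> V" "\<not> centered_within E H (m * K)"
  obtains t where "embedded E t" "set_tree t \<subseteq> H" "fib (m + 2) \<le> size t"
proof -
  have "rooted_tree m \<and> hanging_trees m"
    by (induction m) (auto intro: rooted_tree_0 hanging_trees_0 rooted_tree_Suc hanging_trees_Suc)
  moreover obtain C where C: "C \<subseteq> H" "linked E C" "\<not> centered_within E C (m * K)"
    using centered_within_components[of H E "m * K"] assms(2) by blast
  moreover obtain v where "v \<in> C" using C(2) by (auto simp: linked_def)
  ultimately obtain l r where "embedded E (Node l v r)" "set_tree (Node l v r) \<subseteq> C"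
    "fib (m + 2) \<le> size (Node l v r)"
    using assms(1) unfolding rooted_tree_def by (meson subset_trans)
  then show thesis using that C(1) by blast
qed

end

subsection \<open>Linear colorings of binary trees\<close>

text \<open>On distinct vertices this is the unique color condition of linear colorings, counted
  along the list so that parities can be compared.\<close>

definition path_centered :: "('a \<times> 'a) set \<Rightarrow> 'a set \<Rightarrow> ('a \<Rightarrow> 'c) \<Rightarrow> bool" where
  "path_centered E S c \<longleftrightarrow> (\<forall>p. p \<noteq> [] \<and> distinct p \<and> set p \<subseteq> S \<and> walk_in E p \<longrightarrow>
     (\<exists>a. count_list (map c p) a = 1))"

lemma path_centered_mono: "path_centered E S c \<Longrightarrow> R \<subseteq> S \<Longrightarrow> path_centered E R c"
  unfolding path_centered_def by (meson subset_trans)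

text \<open>Each vertex of the tree is represented by the path that leads to it from the
  root.\<close>

fun root_paths :: "'a tree \<Rightarrow> 'a list set" where
  "root_paths Leaf = {}"
| "root_paths (Node l x r) = insert [x] ((#) x ` (root_paths l \<union> root_paths r))"

lemma finite_root_paths: "finite (root_paths t)"
  by (induction t) auto

lemma root_paths_nonempty: "q \<in> root_paths t \<Longrightarrow> q \<noteq> []"
  by (cases t) auto

lemma set_root_paths: "q \<in> root_paths t \<Longrightarrow> set q \<subseteq> set_tree t"
proof (induction t arbitrary: q)
  case (Node l x r)
  then consider "q = [x]" | q' where "q = x # q'" "q' \<in> root_paths l" | q' where "q = x # q'" "q' \<in> root_paths r"
    by auto
  then show ?case using Node.IH by cases auto
qed simp

lemma hangs_root_paths: "hangs E x t \<Longrightarrow> q \<in> root_paths t \<Longrightarrow> (x, hd q) \<in> E"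
  by (cases t) auto

lemma root_path_is_path: "embedded E t \<Longrightarrow> q \<in> root_paths t \<Longrightarrow> distinct q \<and> walk_in E q"
proof (induction t arbitrary: q)
  case (Node l x r)
  have step: "distinct (x # q') \<and> walk_in E (x # q')"
    if "q' \<in> root_paths s" "distinct q' \<and> walk_in E q'" "hangs E x s" "x \<notin> set_tree s" for q' s
    using that set_root_paths[of q' s] hangs_root_paths[of E x s q'] by (cases q') auto
  consider "q = [x]" | q' where "q = x # q'" "q' \<in> root_paths l" | q' where "q = x # q'" "q' \<in> root_paths r"
    using Node.prems(2) by auto
  then show ?case using Node step by cases auto
qed simp

lemma card_root_paths: "embedded E t \<Longrightarrow> card (root_paths t) = size t"
proof (induction t)
  case (Node l x r)
  have disj: "root_paths l \<inter> root_paths r = {}"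
  proof (rule ccontr)
    assume "root_paths l \<inter> root_paths r \<noteq> {}"
    then obtain q where q: "q \<in> root_paths l" "q \<in> root_paths r" by blast
    then have "hd q \<in> set_tree l \<inter> set_tree r"
      using set_root_paths root_paths_nonempty by (metis IntI hd_in_set subsetD)
    then show False using Node.prems by auto
  qed
  have "card ((#) x ` (root_paths l \<union> root_paths r)) = card (root_paths l \<union> root_paths r)"
    by (rule card_image) simp
  also have "\<dots> = card (root_paths l) + card (root_paths r)"
    by (rule card_Un_disjoint[OF finite_root_paths finite_root_paths disj])
  finally have "card ((#) x ` (root_paths l \<union> root_paths r)) = size l + size r"
    using Node by simp
  moreover have "[x] \<notin> (#) x ` (root_paths l \<union> root_paths r)" using root_paths_nonempty by auto
  ultimately show ?case using finite_root_paths[of l] finite_root_paths[of r] by simp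
qed simp

definition color_parity :: "('a \<Rightarrow> 'c) \<Rightarrow> 'a list \<Rightarrow> 'c set" where
  "color_parity c p = {a. odd (count_list (map c p) a)}"

lemma color_parity_nonempty:
  assumes "path_centered E S c" "p \<noteq> []" "distinct p" "set p \<subseteq> S" "walk_in E p"
  shows "color_parity c p \<noteq> {}"
proof -
  obtain a where "count_list (map c p) a = 1" using assms unfolding path_centered_def by blast
  then have "a \<in> color_parity c p" by (simp add: color_parity_def)
  then show ?thesis by blast
qed

text \<open>Prepending \<open>x\<close> toggles the color \<open>c x\<close>. Solved for
  \<open>q\<close>, this turns a class at a node into one class in each subtree.\<close>

lemma color_parity_Cons:
  "color_parity c (x # q) = p \<longleftrightarrow> color_parity c q = (p - {c x}) \<union> ({c x} - p)"
  by (auto simp: color_parity_def set_eq_iff)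

text \<open>The path joining two root paths of equal parity has every color an even number of times,
  except that of the branching vertex.\<close>

lemma branch_color_absent:
  assumes "sym E" "embedded E (Node l x r)" "path_centered E (set_tree (Node l x r)) c"
    and q: "q \<in> root_paths l" "q' \<in> root_paths r" "color_parity c q = color_parity c q'"
  shows "c x \<notin> c ` set q \<and> c x \<notin> c ` set q'"
proof -
  let ?p = "rev q @ x # q'"
  have path: "distinct q" "walk_in E q" "distinct q'" "walk_in E q'" "q \<noteq> []" "q' \<noteq> []"
    "set q \<subseteq> set_tree l" "set q' \<subseteq> set_tree r"
    using root_path_is_path[of E l q] root_path_is_path[of E r q'] root_paths_nonempty[of q l]
      root_paths_nonempty[of q' r] set_root_paths[of q l] set_root_paths[of q' r] assms(2) q
    by auto
  have "walk_in E (rev q)"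
    unfolding successively_rev
    by (rule successively_mono[OF path(2)]) (use assms(1) in \<open>auto dest: symD\<close>)
  moreover have "(hd q, x) \<in> E" "(x, hd q') \<in> E"
    using hangs_root_paths[of E x l q] hangs_root_paths[of E x r q'] assms(1,2) q by (auto dest: symD)
  ultimately have "walk_in E ?p"
    using path by (cases q') (auto simp: successively_append_iff last_rev)
  moreover have "distinct ?p" using path assms(2) by auto
  moreover have "set ?p \<subseteq> set_tree (Node l x r)" using path by auto
  ultimately obtain a where a: "count_list (map c ?p) a = 1"
    using assms(3) unfolding path_centered_def by blast
  have "even (count_list (map c q) a + count_list (map c q') a)"
    using q(3) by (auto simp: color_parity_def set_eq_iff)
  moreover have sum: "count_list (map c q) a + count_list (map c q') a + (if c x = a then 1 else 0) = 1"
    using a by (auto simp: count_list_append rev_map[symmetric] split: if_splits)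
  ultimately have "c x = a" by (metis add.right_neutral odd_one)
  then have "count_list (map c q) (c x) = 0" "count_list (map c q') (c x) = 0" using sum by auto
  then show ?thesis by (simp add: count_list_0_iff)
qed

text \<open>\<open>S\<close> bounds the colors available on the paths of the class. A node can
  double the class only when both subtrees contribute; then \<open>branch_color_absent\<close>
  removes \<open>c x\<close> from the colors available below, which pays for the doubling.\<close>

lemma card_parity_class:
  assumes "sym E" "embedded E t" "path_centered E (set_tree t) c" "finite S"
    and "\<forall>q\<in>root_paths t. color_parity c q = p \<longrightarrow> c ` set q \<subseteq> S"
  shows "card {q \<in> root_paths t. color_parity c q = p} \<le> 2 ^ card S"
  using assms(2-)
proof (induction t arbitrary: p S)
  case Leaf
  then show ?case by simp
next
  case (Node l x r)
  define p' where "p' = (p - {c x}) \<union> ({c x} - p)"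
  define L where "L = {q \<in> root_paths l. color_parity c q = p'}"
  define R where "R = {q \<in> root_paths r. color_parity c q = p'}"
  have par: "color_parity c (x # q) = p \<longleftrightarrow> color_parity c q = p'" for q
    unfolding p'_def by (rule color_parity_Cons)
  have emb: "embedded E l" "embedded E r" using Node.prems(1) by auto
  have pc: "path_centered E (set_tree l) c" "path_centered E (set_tree r) c"
    using Node.prems(2) path_centered_mono by (metis Un_upper1 Un_upper2 tree.set(2) le_supI1 le_supI2 subset_insertI2)+
  have sub: "insert (c x) (c ` set q) \<subseteq> S" if "q \<in> L \<union> R" for q
  proof -
    have "x # q \<in> root_paths (Node l x r)" "color_parity c (x # q) = p"
      using that par by (auto simp: L_def R_def)
    then show ?thesis using Node.prems(4) by fastforce
  qed
  have card_class: "card L \<le> 2 ^ card S'" "card R \<le> 2 ^ card S'"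
    if "S' \<subseteq> S" "\<forall>q\<in>L \<union> R. c ` set q \<subseteq> S'" for S'
  proof -
    have "finite S'" using that(1) Node.prems(3) finite_subset by blast
    then show "card L \<le> 2 ^ card S'" "card R \<le> 2 ^ card S'"
      using Node.IH(1)[OF emb(1) pc(1), of S' p'] Node.IH(2)[OF emb(2) pc(2), of S' p'] that(2)
      unfolding L_def R_def by auto
  qed
  have no_empty: "color_parity c q \<noteq> {}" if "q \<in> L \<union> R" for q
  proof -
    have "q \<in> root_paths l \<or> q \<in> root_paths r" using that by (auto simp: L_def R_def)
    then show ?thesis
      using color_parity_nonempty[OF pc(1)] color_parity_nonempty[OF pc(2)] emb
        root_path_is_path root_paths_nonempty set_root_paths by metis
  qed
  have eq: "{q \<in> root_paths (Node l x r). color_parity c q = p} =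
      (if p' = {} then {[x]} else {}) \<union> (#) x ` (L \<union> R)"
  proof -
    have "color_parity c [x] = p \<longleftrightarrow> p' = {}" using par[of "[]"] by (auto simp: color_parity_def)
    moreover have "{q \<in> root_paths (Node l x r). color_parity c q = p} = {q \<in> {[x]}. color_parity c q = p} \<union>
        (#) x ` {q \<in> root_paths l \<union> root_paths r. color_parity c (x # q) = p}" by auto
    moreover have "{q \<in> root_paths l \<union> root_paths r. color_parity c (x # q) = p} = L \<union> R"
      unfolding par L_def R_def by blast
    ultimately show ?thesis by auto
  qed
  show ?case
  proof (cases "p' = {}")
    case True
    \<comment> \<open>Nonempty paths have nonempty parity sets, so the class consists of
      \<open>[x]\<close> alone.\<close>
    then have "L \<union> R = {}" using no_empty by (fastforce simp: L_def R_def)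
    then show ?thesis unfolding eq using True by simp
  next
    case False
    have "card {q \<in> root_paths (Node l x r). color_parity c q = p} = card (L \<union> R)"
      unfolding eq using False by (simp add: card_image)
    also have "\<dots> \<le> card L + card R" by (rule card_Un_le)
    also have "\<dots> \<le> 2 ^ card S"
    proof (cases "L = {} \<or> R = {}")
      case True
      then show ?thesis using card_class[of S] sub by auto
    next
      case False
      then obtain q1 q2 where q12: "q1 \<in> L" "q2 \<in> R" by blast
      \<comment> \<open>Each path is paired with the fixed representative \<open>q1\<close> or
        \<open>q2\<close> in the other subtree.\<close>
      have "c x \<notin> c ` set q" if "q \<in> L \<union> R" for q
        using that
      proof
        assume "q \<in> L"
        then show ?thesis
          using branch_color_absent[OF assms(1) Node.prems(1,2), of q q2] q12 by (simp add: L_def R_def)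
      next
        assume "q \<in> R"
        then show ?thesis
          using branch_color_absent[OF assms(1) Node.prems(1,2), of q1 q] q12 by (simp add: L_def R_def)
      qed
      then have "\<forall>q\<in>L \<union> R. c ` set q \<subseteq> S - {c x}" using sub by blast
      then have "card L \<le> 2 ^ card (S - {c x})" "card R \<le> 2 ^ card (S - {c x})"
        using card_class[of "S - {c x}"] by blast+
      moreover have "c x \<in> S" using sub[of q1] q12 by blast
      then have "card S = Suc (card (S - {c x}))" using card_Suc_Diff1[OF Node.prems(3)] by metis
      ultimately show ?thesis by simp
    qed
    finally show ?thesis .
  qed
qed

lemma size_embedded_le:
  assumes "sym E" "embedded E t" "path_centered E (set_tree t) c" "c ` set_tree t \<subseteq> S" "finite S"
  shows "size t \<le> 4 ^ card S"
proof -
  have "root_paths t \<subseteq> (\<Union>p\<in>Pow S. {q \<in> root_paths t. color_parity c q = p})"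
  proof
    fix q assume q: "q \<in> root_paths t"
    have "color_parity c q \<subseteq> c ` set q"
      by (auto simp: color_parity_def) (metis count_list_0_iff even_zero image_set)
    then have "color_parity c q \<in> Pow S" using set_root_paths[OF q] assms(4) by blast
    then show "q \<in> (\<Union>p\<in>Pow S. {q \<in> root_paths t. color_parity c q = p})" using q by blast
  qed
  moreover have "finite (\<Union>p\<in>Pow S. {q \<in> root_paths t. color_parity c q = p})"
    using assms(5) finite_root_paths[of t] by auto
  ultimately have "size t \<le> card (\<Union>p\<in>Pow S. {q \<in> root_paths t. color_parity c q = p})"
    using card_mono card_root_paths[OF assms(2)] by metis
  also have "\<dots> \<le> (\<Sum>p\<in>Pow S. card {q \<in> root_paths t. color_parity c q = p})"
    using assms(5) by (intro card_UN_le) simp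
  also have "\<dots> \<le> (\<Sum>p\<in>Pow S. 2 ^ card S)"
  proof (rule sum_mono)
    fix p
    have "\<forall>q\<in>root_paths t. color_parity c q = p \<longrightarrow> c ` set q \<subseteq> S"
      using set_root_paths assms(4) by blast
    then show "card {q \<in> root_paths t. color_parity c q = p} \<le> 2 ^ card S"
      using card_parity_class[OF assms(1,2,3,5)] by blast
  qed
  also have "\<dots> = 4 ^ card S"
    using assms(5) by (simp add: card_Pow power_mult_distrib[symmetric])
  finally show ?thesis .
qed

subsection \<open>Treewidth and chromatic numbers\<close>

text \<open>Library connectedness is strong connectedness of the symmetric closure of
  \<open>X\<close>, whose arcs stay inside the symmetric relation \<open>E\<close>. If no edge left
  \<open>A\<close>, everything reachable from \<open>u\<close> would stay in \<open>A\<close>. Since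
  \<open>E\<close> may exceed the arcs of \<open>X\<close>, subgraphs are covered.\<close>

lemma linked_of_connected:
  assumes "Digraph_Component.connected X" "verts X = W"
    and "\<And>e. e \<in> arcs X \<Longrightarrow> (tail X e, head X e) \<in> E" "sym E"
  shows "linked E W"
  unfolding linked_def
proof (intro conjI allI impI)
  let ?M = "with_proj (mk_symmetric X)"
  have M: "verts ?M = W" "arcs_ends ?M \<subseteq> E"
    using assms(2-4) by (auto simp: mk_symmetric_def dest: symD)
  have conn: "verts ?M \<noteq> {}" "\<And>u v. u \<in> W \<Longrightarrow> v \<in> W \<Longrightarrow> u \<rightarrow>\<^sup>*\<^bsub>?M\<^esub> v"
    using assms(1) M(1) unfolding Digraph_Component.connected_def strongly_connected_def by blast+
  then show "W \<noteq> {}" using M(1) by simp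
  fix A assume A: "A \<noteq> {} \<and> A \<subset> W"
  then obtain u v where uv: "u \<in> A" "v \<in> W" "v \<notin> A" by blast
  show "\<exists>a\<in>A. \<exists>b\<in>W - A. (a, b) \<in> E"
  proof (rule ccontr)
    assume no: "\<not> ?thesis"
    have "u \<rightarrow>\<^sup>*\<^bsub>?M\<^esub> v" using conn(2) uv A by blast
    then have "(u, v) \<in> rtrancl_on W (arcs_ends ?M)" using M(1) by (simp add: reachable_def)
    then have "v \<in> A"
    proof (induction rule: rtrancl_on_induct)
      case base
      show ?case by (rule uv(1))
    next
      case (step y z)
      then show ?case using no M(2) by blast
    qed
    then show False using uv by blast
  qed
qed

lemma vwalk_arcs_successively: "set (vwalk_arcs p) \<subseteq> E \<longleftrightarrow> walk_in E p"
  by (induction p rule: vwalk_arcs.induct) auto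

lemma vpath_with_proj: "vpath p (with_proj G) \<longleftrightarrow> p \<noteq> [] \<and> distinct p \<and> set p \<subseteq> pverts G \<and> walk_in (parcs G) p"
  by (auto simp: vpath_def vwalk_def vwalk_arcs_successively)

lemma pair_graph_parcs:
  assumes "pair_graph G"
  shows "sym (parcs G)" "(x, x) \<notin> parcs G" "finite (pverts G)" "parcs G \<subseteq> pverts G \<times> pverts G"
proof -
  interpret pair_graph G by fact
  show "sym (parcs G)" using pair_sym_arcs by (simp add: symmetric_def)
  show "(x, x) \<notin> parcs G" using pair_no_loops[of "(x, x)"] by auto
  show "finite (pverts G)" by (rule pair_finite_verts)
  show "parcs G \<subseteq> pverts G \<times> pverts G" using in_arcsD1 in_arcsD2 by auto
qed

text \<open>It shows that tree decompositions exist, so that a least width can be taken.\<close>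

lemma trivial_tree_decomposition:
  fixes G :: "'a pair_pre_digraph"
  assumes "pair_graph G"
  shows "tree_decomposition G \<lparr>pverts = {0}, parcs = {}\<rparr> (\<lambda>_. pverts G)"
proof -
  let ?T = "\<lparr>pverts = {0}, parcs = {}\<rparr> :: nat pair_pre_digraph"
  have point: "Digraph_Component.connected X" if "verts X = {0}" for X :: "(nat, nat \<times> nat) pre_digraph"
    using that by (simp add: Digraph_Component.connected_def strongly_connected_def mk_symmetric_def reachable_def)
  have "pair_graph ?T"
    by unfold_locales (auto simp: symmetric_def sym_def)
  moreover have "\<not> undirected_cycle ?T p" for p
    by (simp add: undirected_cycle_def)
  ultimately have "undirected_tree ?T"
    using point[of "with_proj ?T"] by (simp add: undirected_tree_def)
  then show ?thesis
    using point pair_graph_parcs(4)[OF assms] by (auto simp: tree_decomposition_def)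
qed

text \<open>A set of integers need not have a least element. Shifted by one, widths are natural
  numbers, so a minimizing decomposition exists.\<close>

lemma optimal_tree_decomposition:
  fixes G :: "'a pair_pre_digraph"
  assumes "pair_graph G"
  obtains T B where "tree_decomposition G T B" "decomposition_width T B = treewidth G"
proof -
  define width :: "nat pair_pre_digraph \<times> (nat \<Rightarrow> 'a set) \<Rightarrow> nat"
    where "width = (\<lambda>(T, B). nat (decomposition_width T B + 1))"
  let ?dec = "\<lambda>(T, B). tree_decomposition G T B"
  have dw: "decomposition_width T B = int (width (T, B)) - 1" for T B
    by (simp add: width_def decomposition_width_def)
  obtain d where d: "?dec d" "\<And>e. ?dec e \<Longrightarrow> width d \<le> width e"
    using ex_has_least_nat[of ?dec "(\<lparr>pverts = {0}, parcs = {}\<rparr>, \<lambda>_. pverts G)" width]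
      trivial_tree_decomposition[OF assms] by auto
  obtain T B where TB: "d = (T, B)" by (cases d)
  have "treewidth G = decomposition_width T B"
    unfolding treewidth_def
  proof (rule Least_equality)
    show "\<exists>T' B'. tree_decomposition G T' B' \<and> decomposition_width T' B' = decomposition_width T B"
      using d(1) TB by auto
    fix w assume "\<exists>T' B'. tree_decomposition G T' B' \<and> decomposition_width T' B' = w"
    then obtain T' B' where "tree_decomposition G T' B'" "decomposition_width T' B' = w" by blast
    then show "decomposition_width T B \<le> w" using d(2)[of "(T', B')"] TB by (simp add: dw)
  qed
  then show thesis using that[of T B] d(1) TB by simp
qed

text \<open>The lower bound ensures that \<open>nat\<close> preserves the treewidth plus
  one.\<close>

lemma splittable_treewidth:
  assumes "pair_graph G"
  shows "splittable (parcs G) (pverts G) (nat (treewidth G + 1))" "-1 \<le> treewidth G"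
proof -
  obtain T B where TB: "tree_decomposition G T B" "decomposition_width T B = treewidth G"
    using optimal_tree_decomposition[OF assms] by blast
  show "-1 \<le> treewidth G" unfolding TB(2)[symmetric] decomposition_width_def by simp
  have K: "nat (treewidth G + 1) = Max ((\<lambda>t. card (B t)) ` pverts T)"
    unfolding TB(2)[symmetric] decomposition_width_def by simp
  have tree: "undirected_tree T" and cover: "(\<Union>t\<in>pverts T. B t) = pverts G"
    and edges: "\<forall>(u, v)\<in>parcs G. \<exists>t\<in>pverts T. u \<in> B t \<and> v \<in> B t"
    and vertices: "\<forall>v\<in>pverts G. Digraph_Component.connected (with_proj T \<restriction> {t \<in> pverts T. v \<in> B t})"
    using TB(1) by (auto simp: tree_decomposition_def)
  have T: "pair_graph T" using tree by (simp add: undirected_tree_def)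
  note T' = pair_graph_parcs[OF T] and G' = pair_graph_parcs[OF assms]
  \<comment> \<open>With \<open>UNIV\<close> as edge relation the arc condition is trivial; only
    nonemptiness is extracted from \<open>linked\<close>.\<close>
  have "pverts T \<noteq> {}"
    using tree linked_of_connected[of "with_proj T" "pverts T" UNIV]
    by (auto simp: undirected_tree_def linked_def sym_def)
  have acyclic: "acyclic_on (parcs T) (pverts T)"
    unfolding acyclic_on_def
  proof (intro allI impI)
    fix p assume p: "distinct p \<and> set p \<subseteq> pverts T \<and> walk_in (parcs T) p \<and> 3 \<le> length p"
    then have "vpath p (with_proj T)" by (auto simp: vpath_with_proj)
    then show "(last p, hd p) \<notin> parcs T"
      using tree p unfolding undirected_tree_def undirected_cycle_def by blast
  qed
  have bags: "finite (B t) \<and> card (B t) \<le> nat (treewidth G + 1)" if "t \<in> pverts T" for t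
  proof
    show "finite (B t)" using that cover G'(3) by (metis UN_upper finite_subset)
    show "card (B t) \<le> nat (treewidth G + 1)" unfolding K using that T'(3) by simp
  qed
  have vertex: "linked (parcs T) {t \<in> pverts T. v \<in> B t}" if "v \<in> pverts G" for v
    using linked_of_connected[of "with_proj T \<restriction> {t \<in> pverts T. v \<in> B t}"] vertices that T'(1) by auto
  show "splittable (parcs G) (pverts G) (nat (treewidth G + 1))"
  proof
    show "sym (parcs G)" "finite (pverts G)" by (rule G')+
    fix H n assume H: "H \<subseteq> pverts G" "\<not> centered_within (parcs G) H (n + nat (treewidth G + 1))"
    show "\<exists>C D. C \<subseteq> H \<and> D \<subseteq> H \<and> C \<inter> D = {} \<and> linked (parcs G) C \<and> linked (parcs G) D \<and>
        \<not> centered_within (parcs G) C n \<and> \<not> centered_within (parcs G) D n"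
    proof (rule disjoint_uncentered_sets[OF G'(1) T'(1,2,3) \<open>pverts T \<noteq> {}\<close> acyclic bags _ vertex H])
      show "\<exists>t\<in>pverts T. u \<in> B t \<and> v \<in> B t" if "(u, v) \<in> parcs G" for u v
        using edges that by blast
    qed blast+
  qed
qed

text \<open>An injective coloring is linear, so the least number of colors is taken over a nonempty
  set.\<close>

lemma chi_lin_attained:
  fixes G :: "'a pair_pre_digraph"
  assumes "pair_graph G"
  obtains c where "linear_coloring G c" "card (c ` pverts G) = chi_lin G"
proof -
  obtain f :: "'a \<Rightarrow> nat" where f: "inj_on f (pverts G)"
    using finite_imp_inj_to_nat_seg[OF pair_graph_parcs(3)[OF assms]] by blast
  have "linear_coloring G (int \<circ> f)"
    unfolding linear_coloring_def
  proof (intro allI impI)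
    fix p assume "vpath p (with_proj G)"
    then have p: "p \<noteq> []" "set p \<subseteq> pverts G" by (auto simp: vpath_with_proj)
    then have "inj_on f (set p)" using f inj_on_subset by blast
    then show "has_unique_color (int \<circ> f) (set p)"
      using p(1) unfolding has_unique_color_def inj_on_def
      by (intro bexI[of _ "hd p"]) auto
  qed
  then have "\<exists>k c. linear_coloring G c \<and> card (c ` pverts G) = k" by blast
  then have "\<exists>c. linear_coloring G c \<and> card (c ` pverts G) = chi_lin G"
    unfolding chi_lin_def by (rule LeastI_ex)
  then show thesis using that by blast
qed

lemma path_centered_linear_coloring:
  assumes "linear_coloring G c"
  shows "path_centered (parcs G) (pverts G) c"
  unfolding path_centered_def
proof (intro allI impI)
  fix p assume p: "p \<noteq> [] \<and> distinct p \<and> set p \<subseteq> pverts G \<and> walk_in (parcs G) p"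
  then have "has_unique_color c (set p)"
    using assms by (simp add: linear_coloring_def vpath_with_proj)
  then obtain v where v: "v \<in> set p" "\<forall>w\<in>set p. c w = c v \<longrightarrow> w = v"
    by (auto simp: has_unique_color_def)
  then obtain q r where qr: "p = q @ v # r" by (meson split_list)
  have "c v \<notin> set (map c q)" "c v \<notin> set (map c r)" using v p qr by auto
  then have "count_list (map c p) (c v) = 1"
    unfolding qr by (simp add: count_list_append count_list_0_iff)
  then show "\<exists>a. count_list (map c p) a = 1" by blast
qed

lemma chi_cen_le:
  assumes "pair_graph G" "centered_within (parcs G) (pverts G) n"
  shows "chi_cen G \<le> n"
proof -
  obtain c where c: "c ` pverts G \<subseteq> {0..<int n}"
    "\<forall>W. W \<subseteq> pverts G \<and> linked (parcs G) W \<longrightarrow> has_unique_color c W"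
    using assms(2) unfolding centered_within_def by (elim exE conjE)
  have "centered_coloring G c"
    unfolding centered_coloring_def
  proof (intro allI impI, elim conjE)
    fix H assume H: "subgraph (with_proj H) (with_proj G)" "Digraph_Component.connected (with_proj H)"
    have sub: "pverts H \<subseteq> pverts G" "parcs H \<subseteq> parcs G" using H(1) by (auto simp: subgraph_def)
    \<comment> \<open>The subgraph may omit edges of \<open>G\<close>, but its vertex set is still
      linked by the edges of \<open>G\<close>.\<close>
    have "linked (parcs G) (pverts H)"
      by (rule linked_of_connected[OF H(2)]) (use sub(2) pair_graph_parcs(1)[OF assms(1)] in auto)
    then show "has_unique_color c (pverts H)" using c(2) sub(1) by blast
  qed
  then have "chi_cen G \<le> card (c ` pverts G)" unfolding chi_cen_def by (intro Least_le) blast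
  also have "\<dots> \<le> card {0..<int n}" using c(1) by (intro card_mono) auto
  finally show ?thesis by simp
qed

section \<open>Numerical estimates\<close>

lemma golden_ratio_power_le_fib: "((1 + sqrt 5) / 2) ^ m \<le> real (fib (m + 2))"
proof (induction m rule: fib.induct)
  case 2
  have "sqrt 5 \<le> 3" by (rule real_le_lsqrt) auto
  then show ?case by (simp add: numeral_eq_Suc)
next
  case (3 m)
  \<comment> \<open>The powers of the golden ratio satisfy the Fibonacci recurrence, its square
    being itself plus one.\<close>
  have "((1 + sqrt 5) / 2)\<^sup>2 = (1 + sqrt 5) / 2 + 1"
    by (simp add: power2_eq_square field_simps)
  then have "((1 + sqrt 5) / 2) ^ Suc (Suc m) = ((1 + sqrt 5) / 2) ^ m * ((1 + sqrt 5) / 2 + 1)"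
    by (simp add: power2_eq_square)
  also have "\<dots> = ((1 + sqrt 5) / 2) ^ Suc m + ((1 + sqrt 5) / 2) ^ m"
    by (simp add: algebra_simps)
  also have "\<dots> \<le> real (fib (Suc m + 2)) + real (fib (m + 2))"
    using 3 by simp
  finally show ?case by simp
qed (simp add: numeral_eq_Suc)

text \<open>From \<open>2 ^ 3 \<le> 3 ^ 2\<close> and \<open>3 ^ 5 \<le> 2 ^ 8\<close>. The lower
  bound yields \<open>2 \<le> (log 2 3)\<^sup>2\<close>, the upper one serves
  \<open>c < 3.7\<close>.\<close>

lemma log2_3_bounds: "3 / 2 \<le> log 2 3" "log 2 3 \<le> 8 / 5"
proof -
  have "3 = log 2 (2 ^ 3 :: real)" by (subst log_nat_power) simp_all
  also have "\<dots> \<le> log 2 (3 ^ 2)" by simp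
  also have "\<dots> = 2 * log 2 3" by (subst log_nat_power) simp_all
  finally show "3 / 2 \<le> log 2 3" by simp
  have "5 * log 2 3 = log 2 (3 ^ 5)" by (subst log_nat_power) simp_all
  also have "\<dots> \<le> log 2 (2 ^ 8)" by simp
  also have "\<dots> = 8" by (subst log_nat_power) simp_all
  finally show "log 2 3 \<le> 8 / 5" by simp
qed

text \<open>The fraction comes from \<open>2 ^ 9 \<le> 1.618 ^ 13\<close>. It is just large enough
  for \<open>(8 / 5)\<^sup>2 < 3.7 * (9 / 13)\<close>, which is 2.56 against about 2.5615.\<close>

lemma log2_golden_ratio_bound: "9 / 13 \<le> log 2 ((1 + sqrt 5) / 2)"
proof -
  have sq: "2 * 1.118 \<le> sqrt 5" by (rule real_le_rsqrt) (simp add: power2_eq_square)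
  have "(1.618::real) ^ 13 \<ge> 2 ^ 9" by (simp add: power_divide)
  also have "(1.618::real) ^ 13 \<le> ((1 + sqrt 5) / 2) ^ 13" using sq by (intro power_mono) auto
  finally have "log 2 (2 ^ 9) \<le> log 2 (((1 + sqrt 5) / 2) ^ 13)"
    by (subst log_le_cancel_iff) (auto intro: add_pos_nonneg)
  then have "9 \<le> 13 * log 2 ((1 + sqrt 5) / 2)"
    by (subst (asm) (1 2) log_nat_power) (auto intro: add_pos_nonneg)
  then show ?thesis by simp
qed

lemma log2_power_le:
  fixes x :: real
  assumes "x ^ m \<le> 2 ^ n" "0 < x"
  shows "real m * log 2 x \<le> real n"
proof -
  have "log 2 (x ^ m) \<le> log 2 (2 ^ n)" using assms by (subst log_le_cancel_iff) simp_all
  then show ?thesis using assms(2) by (simp add: log_nat_power)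
qed

theorem theorem3p5:
  fixes G :: "'a pair_pre_digraph" and \<alpha> c :: real
  assumes "pair_graph G"
    and "\<alpha> = log 2 3 / log 2 ((1 + sqrt 5) / 2)"
    and "c = \<alpha> * log 2 3"
  shows "c < 3.7 \<and>
    real (chi_cen G) \<le> c * (real_of_int (treewidth G) + 1) * (real (chi_lin G) + 1 / log 2 3)"
proof
  define \<phi> where "\<phi> = log 2 ((1 + sqrt 5) / 2)"
  define K where "K = nat (treewidth G + 1)"
  define k where "k = chi_lin G"
  have \<phi>: "9 / 13 \<le> \<phi>" unfolding \<phi>_def by (rule log2_golden_ratio_bound)
  have c: "c = (log 2 3)\<^sup>2 / \<phi>" using assms(2,3) by (simp add: \<phi>_def power2_eq_square)
  have "(log 2 3)\<^sup>2 \<le> (8 / 5)\<^sup>2" using log2_3_bounds by (intro power_mono) auto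
  also have "\<dots> < 3.7 * (9 / 13)" by (simp add: power2_eq_square)
  also have "\<dots> \<le> 3.7 * \<phi>" using \<phi> by simp
  finally show "c < 3.7" unfolding c using \<phi> by (simp add: pos_divide_less_eq)
  interpret splittable "parcs G" "pverts G" K
    unfolding K_def by (rule splittable_treewidth(1)[OF assms(1)])
  obtain col where col: "linear_coloring G col" "card (col ` pverts G) = k"
    using chi_lin_attained[OF assms(1)] unfolding k_def by blast
  have bound: "real m * \<phi> \<le> 2 * real k" if not: "\<not> centered_within (parcs G) (pverts G) (m * K)" for m
  proof -
    obtain t where t: "embedded (parcs G) t" "set_tree t \<subseteq> pverts G" "fib (m + 2) \<le> size t"
      using embedded_tree_exists[OF order_refl not] by blast
    have "path_centered (parcs G) (set_tree t) col"
      using path_centered_linear_coloring[OF col(1)] t(2) by (rule path_centered_mono)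
    then have "size t \<le> 4 ^ k"
      using size_embedded_le[OF sym t(1), of col "col ` pverts G"] t(2) finite col(2) by auto
    then have "fib (m + 2) \<le> 4 ^ k" using t(3) by linarith
    then have "real (fib (m + 2)) \<le> real (4 ^ k)" by (simp only: of_nat_le_iff)
    then have "((1 + sqrt 5) / 2) ^ m \<le> 2 ^ (2 * k)"
      using golden_ratio_power_le_fib[of m] by (simp add: power_mult)
    moreover have "0 < (1 + sqrt 5) / 2" by (simp add: add_pos_nonneg)
    ultimately have "real m * \<phi> \<le> real (2 * k)" unfolding \<phi>_def by (intro log2_power_le)
    then show ?thesis by simp
  qed
  obtain h where h: "centered_within (parcs G) (pverts G) (h * K)" "real h * \<phi> \<le> 2 * real k + \<phi>"
  proof -
    \<comment> \<open>\<open>Suc m\<close> exceeds \<open>2 * real k / \<phi>\<close>, which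
      contradicts the conclusion of \<open>bound\<close>, so \<open>Suc m * K\<close> colors
      suffice. Rounding up costs at most one, whence the summand \<open>\<phi>\<close>.\<close>
    define m where "m = nat \<lfloor>2 * real k / \<phi>\<rfloor>"
    have "real (Suc m) > 2 * real k / \<phi>" unfolding m_def by linarith
    then have "real (Suc m) * \<phi> > 2 * real k" using \<phi> by (simp add: pos_divide_less_eq)
    then have "centered_within (parcs G) (pverts G) (Suc m * K)" using bound[of "Suc m"] by linarith
    moreover have "real m \<le> 2 * real k / \<phi>" unfolding m_def using \<phi> by simp
    then have "real m * \<phi> \<le> 2 * real k" using \<phi> by (simp add: pos_le_divide_eq)
    then have "real (Suc m) * \<phi> \<le> 2 * real k + \<phi>" by (simp add: algebra_simps)
    ultimately show thesis by (rule that)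
  qed
  have "\<phi> \<le> 1"
  proof -
    have "sqrt 5 \<le> 3" by (rule real_le_lsqrt) auto
    then have "log 2 ((1 + sqrt 5) / 2) \<le> log 2 2" by (subst log_le_cancel_iff) (auto intro: add_pos_nonneg)
    then show ?thesis by (simp add: \<phi>_def)
  qed
  have "(3 / 2)\<^sup>2 \<le> (log 2 3)\<^sup>2" using log2_3_bounds by (intro power_mono) auto
  then have "2 \<le> (log 2 3)\<^sup>2" by (simp add: power2_eq_square)
  then have "2 * real k \<le> (log 2 3)\<^sup>2 * real k" by (rule mult_right_mono) simp
  moreover have "1 \<le> log 2 3" using log2_3_bounds by simp
  \<comment> \<open>The summand \<open>\<phi>\<close> is enlarged to \<open>log 2 3\<close>, which
    becomes the term \<open>1 / log 2 3\<close> once \<open>(log 2 3)\<^sup>2\<close> is factored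
    out.\<close>
  ultimately have "real h * \<phi> \<le> (log 2 3)\<^sup>2 * real k + log 2 3"
    using h(2) \<open>\<phi> \<le> 1\<close> by linarith
  also have "\<dots> = (log 2 3)\<^sup>2 * (real k + 1 / log 2 3)"
    using \<open>1 \<le> log 2 3\<close> by (simp add: power2_eq_square field_simps)
  finally have h_le: "real h \<le> c * (real k + 1 / log 2 3)"
    unfolding c using \<phi> by (simp add: pos_le_divide_eq)
  have "real (chi_cen G) \<le> real (h * K)" using chi_cen_le[OF assms(1) h(1)] by (simp only: of_nat_le_iff)
  also have "\<dots> = real h * (real_of_int (treewidth G) + 1)"
    using splittable_treewidth(2)[OF assms(1)] by (simp add: K_def)
  also have "\<dots> \<le> c * (real k + 1 / log 2 3) * (real_of_int (treewidth G) + 1)"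
    using splittable_treewidth(2)[OF assms(1)] by (intro mult_right_mono[OF h_le]) simp
  finally show "real (chi_cen G) \<le> c * (real_of_int (treewidth G) + 1) * (real (chi_lin G) + 1 / log 2 3)"
    by (simp add: k_def mult_ac)
qed

end
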